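(* Let $(\mathcal{A},\tau)$ be a non-commutative probability space, where $\mathcal{A}$ is a unital $C^*$-algebra and $\tau$ is a positive, faithful, tracial linear functional with $\tau(1_{\mathcal{A}})=1$. Let $s,x\in\mathcal{A}$ be self-adjoint random variables that are free with respect to $\tau$, with $s$ semicircular. Then the distribution of $s+i[s,x]$ is the free additive convolution of the distributions of $s$ and $i[s,x]$, i.e. $$\mu_{s+i[s,x]}=\mu_s\boxplus\mu_{i[s,x]}.$$ Moreover, the elements $s$ and $i[s,x]$ are not free.
   Context: Here $[a,b]=ab-ba$, and $i$ is the imaginary unit, so $i[s,x]$ is self-adjoint. For self-adjoint $a\in\mathcal{A}$, $\mu_a$ denotes its distribution with respect to $\tau$: the compactly supported probability measure on $\mathbb{R}$ with $\int t^n\,d\mu_a(t)=\tau(a^n)$ for all $n\ge 0$. The symbol $\boxplus$ denotes free additive convolution: $\mu\boxplus\nu$ is the distribution of $a+b$ for free self-adjoint $a,b$ with distributions $\mu,\nu$; equivalently, the free cumulants satisfy $\kappa_n(\mu\boxplus\nu)=\kappa_n(\mu)+\kappa_n(\nu)$ for all $n\geq 1$. An element $s$ is semicircular if it is self-adjoint and its only non-vanishing free cumulant is $\kappa_2(s)>0$.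
   Formalization: The claim that s and i[s,x] are not free is stated only for x that is not a scalar multiple of 1; for x = c·1 one has i[s,x] = 0, which is free from s, so the claim fails there. The convolution identity is stated for all x. *)

theory Defs
  imports "HOL-Probability.Probability"
begin

text \<open>
  A type of this class is a unital \<open>C\<^sup>*\<close>-algebra. The class \<open>real_normed_algebra_1\<close>
  includes \<open>norm 1 = 1\<close>, so the zero algebra is excluded.
\<close>

class cstar_algebra = real_normed_algebra_1 + banach +
  fixes scaleC :: "complex \<Rightarrow> 'a \<Rightarrow> 'a"  (infixr "*\<^sub>C" 75)
    and adj :: "'a \<Rightarrow> 'a"
  assumes scaleR_scaleC: "r *\<^sub>R x = complex_of_real r *\<^sub>C x"
    and scaleC_add_right: "c *\<^sub>C (x + y) = c *\<^sub>C x + c *\<^sub>C y"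
    and scaleC_add_left: "(c + d) *\<^sub>C x = c *\<^sub>C x + d *\<^sub>C x"
    and scaleC_scaleC: "c *\<^sub>C d *\<^sub>C x = (c * d) *\<^sub>C x"
    and norm_scaleC: "norm (c *\<^sub>C x) = cmod c * norm x"
    and mult_scaleC_left: "(c *\<^sub>C x) * y = c *\<^sub>C (x * y)"
    and mult_scaleC_right: "x * (c *\<^sub>C y) = c *\<^sub>C (x * y)"
    and adj_adj: "adj (adj x) = x"
    and adj_add: "adj (x + y) = adj x + adj y"
    and adj_scaleC: "adj (c *\<^sub>C x) = cnj c *\<^sub>C adj x"
    and adj_mult: "adj (x * y) = adj y * adj x"
    and cstar_identity: "norm (adj x * x) = (norm x)\<^sup>2"

definition self_adjoint :: "'a::cstar_algebra \<Rightarrow> bool" where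
  "self_adjoint a \<longleftrightarrow> adj a = a"

definition commutator :: "'a::ring \<Rightarrow> 'a \<Rightarrow> 'a" where
  "commutator a b = a * b - b * a"

text \<open>
  The type \<open>'a\<close> is the algebra and \<open>\<tau>\<close> the state. Positivity is stated on the elements
  \<open>adj x * x\<close>, which are exactly the positive elements of a \<open>C\<^sup>*\<close>-algebra.
\<close>

locale cstar_prob_space =
  fixes \<tau> :: "'a::cstar_algebra \<Rightarrow> complex"
  assumes state_add: "\<tau> (x + y) = \<tau> x + \<tau> y"
    and state_scaleC: "\<tau> (c *\<^sub>C x) = c * \<tau> x"
    and state_one: "\<tau> 1 = 1"
    and state_positive: "\<tau> (adj x * x) \<in> \<real>\<^sub>\<ge>\<^sub>0"
    and state_faithful: "\<tau> (adj x * x) = 0 \<Longrightarrow> x = 0"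
    and state_tracial: "\<tau> (x * y) = \<tau> (y * x)"

definition unital_subalgebra :: "'a::cstar_algebra set \<Rightarrow> bool" where
  "unital_subalgebra B \<longleftrightarrow>
     1 \<in> B \<and> (\<forall>x\<in>B. \<forall>y\<in>B. x + y \<in> B \<and> x * y \<in> B) \<and> (\<forall>c. \<forall>x\<in>B. c *\<^sub>C x \<in> B)"

text \<open>
  Freeness of a family of subalgebras: products of centred elements in which neighbouring
  factors are taken from different members of the family have expectation zero. Each factor
  carries the index of the subalgebra it is taken from.
\<close>

definition free_family :: "('a::cstar_algebra \<Rightarrow> complex) \<Rightarrow> ('i \<Rightarrow> 'a set) \<Rightarrow> bool" where
  "free_family \<tau> B \<longleftrightarrow>
     (\<forall>ws :: ('i \<times> 'a) list.
        ws \<noteq> [] \<and> distinct_adj (map fst ws) \<and> (\<forall>(i, a)\<in>set ws. a \<in> B i \<and> \<tau> a = 0)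
        \<longrightarrow> \<tau> (prod_list (map snd ws)) = 0)"

text \<open>
  Two elements are free if the unital subalgebras they generate are. For self-adjoint
  elements, the only ones considered here, these are also the generated \<open>*\<close>-algebras.
\<close>

definition free_elems :: "('a::cstar_algebra \<Rightarrow> complex) \<Rightarrow> 'a \<Rightarrow> 'a \<Rightarrow> bool" where
  "free_elems \<tau> a b \<longleftrightarrow>
     free_family \<tau> (\<lambda>i::bool. unital_subalgebra hull {if i then a else b})"

definition noncrossing :: "nat set set \<Rightarrow> bool" where
  "noncrossing P \<longleftrightarrow>
     (\<forall>V\<in>P. \<forall>W\<in>P. V \<noteq> W \<longrightarrow>
        \<not> (\<exists>a\<in>V. \<exists>b\<in>W. \<exists>c\<in>V. \<exists>d\<in>W. a < b \<and> b < c \<and> c < d))"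

definition NC :: "nat \<Rightarrow> nat set set set" where
  "NC n = {P. partition_on {..<n} P \<and> noncrossing P}"

text \<open>
  The free cumulants of a moment sequence \<open>m\<close>, given by the moment-cumulant formula
  \<open>moment_free_cumulant\<close> below, solved for the term of the one-block partition.
\<close>

function free_cumulant :: "(nat \<Rightarrow> 'b::comm_ring_1) \<Rightarrow> nat \<Rightarrow> 'b" where
  "free_cumulant m n =
     m n - (\<Sum>P \<in> NC n - {{{..<n}}}. \<Prod>V\<in>P. free_cumulant m (card V))"
  by auto

lemma card_NC_block_less:
  assumes "P \<in> NC n - {{{..<n}}}" "V \<in> P"
  shows "card V < n"
proof -
  have part: "partition_on {..<n} P" and ne: "P \<noteq> {{..<n}}"
    using assms(1) by (auto simp: NC_def)
  have sub: "V \<subseteq> {..<n}"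
    using part assms(2) by (auto simp: partition_on_def)
  have "V \<noteq> {..<n}"
  proof
    assume V: "V = {..<n}"
    have "W = V" if "W \<in> P" for W
    proof (rule ccontr)
      assume "W \<noteq> V"
      then have "W \<inter> V = {}"
        using part that assms(2) by (auto simp: partition_on_def disjoint_def)
      moreover have "W \<subseteq> V" "W \<noteq> {}"
        using part that V by (auto simp: partition_on_def)
      ultimately show False by blast
    qed
    then have "P = {{..<n}}" using V assms(2) by blast
    then show False using ne by blast
  qed
  then have "V \<subset> {..<n}" using sub by blast
  then have "card V < card {..<n}" by (intro psubset_card_mono) auto
  then show ?thesis by simp
qed

termination
  by (relation "Wellfounded.measure snd") (auto intro: card_NC_block_less)

declare free_cumulant.simps [simp del]

lemma finite_NC: "finite (NC n)"
  by (rule finite_subset[of _ "Pow (Pow {..<n})"]) (auto simp: NC_def partition_on_def)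

lemma moment_free_cumulant:
  assumes "n \<ge> 1"
  shows "m n = (\<Sum>P\<in>NC n. \<Prod>V\<in>P. free_cumulant m (card V))"
proof -
  have "{..<n} \<noteq> {}" using assms by (auto simp: lessThan_empty_iff)
  then have "{{..<n}} \<in> NC n"
    by (auto simp: NC_def noncrossing_def partition_on_def disjoint_def)
  then have "(\<Sum>P\<in>NC n. \<Prod>V\<in>P. free_cumulant m (card V)) =
      free_cumulant m n + (\<Sum>P \<in> NC n - {{{..<n}}}. \<Prod>V\<in>P. free_cumulant m (card V))"
    by (simp add: sum.remove[OF finite_NC])
  then show ?thesis by (simp add: free_cumulant.simps[of m n])
qed

definition elem_cumulant :: "('a::cstar_algebra \<Rightarrow> complex) \<Rightarrow> 'a \<Rightarrow> nat \<Rightarrow> complex" where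
  "elem_cumulant \<tau> a = free_cumulant (\<lambda>k. \<tau> (a ^ k))"

definition measure_cumulant :: "real measure \<Rightarrow> nat \<Rightarrow> real" where
  "measure_cumulant \<mu> = free_cumulant (\<lambda>k. \<integral>t. t ^ k \<partial>\<mu>)"

definition semicircular :: "('a::cstar_algebra \<Rightarrow> complex) \<Rightarrow> 'a \<Rightarrow> bool" where
  "semicircular \<tau> s \<longleftrightarrow>
     self_adjoint s \<and>
     (\<exists>v>0. elem_cumulant \<tau> s 2 = complex_of_real v) \<and>
     (\<forall>n\<ge>1. n \<noteq> 2 \<longrightarrow> elem_cumulant \<tau> s n = 0)"

definition compact_real_distribution :: "real measure \<Rightarrow> bool" where
  "compact_real_distribution \<mu> \<longleftrightarrow>
     real_distribution \<mu> \<and> (\<exists>K. compact K \<and> measure \<mu> K = 1)"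

text \<open>
  Compactly supported measures are determined by their moments, and likewise by their free
  cumulants, so both descriptions below have at most one solution. The first has one whenever
  \<open>a\<close> is self-adjoint and \<open>\<tau>\<close> is a state, the second whenever \<open>\<mu>\<close> and \<open>\<nu>\<close> are compactly
  supported probability measures.
\<close>

definition distribution :: "('a::cstar_algebra \<Rightarrow> complex) \<Rightarrow> 'a \<Rightarrow> real measure" where
  "distribution \<tau> a =
     (THE \<mu>. compact_real_distribution \<mu> \<and>
        (\<forall>n. complex_of_real (\<integral>t. t ^ n \<partial>\<mu>) = \<tau> (a ^ n)))"

definition free_convolution :: "real measure \<Rightarrow> real measure \<Rightarrow> real measure"
    (infixl "\<boxplus>" 65) where
  "\<mu> \<boxplus> \<nu> =
     (THE \<rho>. compact_real_distribution \<rho> \<and>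
        (\<forall>n\<ge>1. measure_cumulant \<rho> n = measure_cumulant \<mu> n + measure_cumulant \<nu> n))"

end

theory Submission
  imports Defs "HOL-Computational_Algebra.Formal_Power_Series" "HOL-Real_Asymp.Real_Asymp"
begin

text \<open>
  Put \<open>y = i[s, x]\<close> and let \<open>E\<close> be the conditional expectation onto the algebra \<open>B\<close> generated by
  \<open>x\<close>. An element \<open>\<Sum>k. a\<^sub>k s c\<^sub>k\<close> with \<open>a\<^sub>k, c\<^sub>k \<in> B\<close> is a \<open>B\<close>-valued semicircular element with
  covariance \<open>\<eta>(b) = v \<Sum>k l. \<tau>(c\<^sub>k b a\<^sub>l) a\<^sub>k c\<^sub>l\<close>. The two cross terms \<open>E[s b y]\<close> and \<open>E[y b s]\<close>
  cancel, so that \<open>s + y\<close> has covariance \<open>b \<mapsto> v \<tau>(b) + \<eta>\<^sub>y(b)\<close>, which is also the covariance of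
  \<open>s' + y\<close> for a copy \<open>s'\<close> of \<open>s\<close> free from \<open>y\<close>. On the level of moments this says that the
  generating functions of \<open>\<tau>(x\<^sup>k y\<^sup>n)\<close> and \<open>\<tau>(x\<^sup>k (s + y)\<^sup>n)\<close> in \<open>n\<close> satisfy two quadratic systems,
  and if \<open>G\<^sub>0\<close> is the moment series of \<open>s + y\<close> and \<open>a = 1 / (1 - v t\<^sup>2 G\<^sub>0)\<close>, then substituting
  \<open>t a\<close> for \<open>t\<close> and multiplying by \<open>a\<close> turns the solution of the first into that of the second. With
  \<open>C(t M(t)) = M(t)\<close> for the moment series \<open>M\<close> and the cumulant series \<open>C\<close>, it follows that the
  cumulant series of \<open>s + y\<close> and \<open>y\<close> differ by \<open>v t\<^sup>2\<close>.

  If \<open>s\<close> and \<open>y\<close> were free, then \<open>\<tau>(s y s y) = 0\<close>, but freeness of \<open>s\<close> and \<open>x\<close> gives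
  \<open>- 2 v\<^sup>2 \<tau>((x - \<tau>(x))\<^sup>2)\<close> for this moment.
\<close>

unbundle fps_syntax

section \<open>Noncrossing partitions of intervals\<close>

text \<open>An arbitrary left end is allowed because cutting a partition of an initial segment
  produces partitions of shifted intervals.\<close>

definition nc_interval :: "nat \<Rightarrow> nat \<Rightarrow> nat set set set" where
  "nc_interval a b = {P. partition_on {a..<b} P \<and> noncrossing P}"

definition block_at :: "nat \<Rightarrow> nat set set \<Rightarrow> nat set" where
  "block_at a P = \<Union>{V \<in> P. a \<in> V}"

text \<open>
  A noncrossing partition of \<open>{a..<b}\<close> is cut at the second element \<open>p\<close> of the block of \<open>a\<close>, with
  \<open>p = b\<close> if that block is \<open>{a}\<close>; then \<open>block_at b\<close> of the empty partition is \<open>{}\<close>.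
\<close>

definition nc_glue :: "nat \<Rightarrow> nat \<Rightarrow> nat set set \<Rightarrow> nat set set \<Rightarrow> nat set set" where
  "nc_glue a p Q R = insert (insert a (block_at p R)) (Q \<union> {V \<in> R. p \<notin> V})"

definition restrict_blocks :: "nat set \<Rightarrow> nat set set \<Rightarrow> nat set set" where
  "restrict_blocks B P = (\<inter>) B ` P - {{}}"

lemma NC_eq_nc_interval: "NC n = nc_interval 0 n"
  by (simp add: NC_def nc_interval_def atLeast0LessThan)

lemma nc_interval_empty [simp]: "nc_interval a a = {{}}"
  by (auto simp: nc_interval_def partition_on_empty noncrossing_def)

lemma finite_nc_interval [simp]: "finite (nc_interval a b)"
  by (rule finite_subset[of _ "Pow (Pow {a..<b})"]) (auto simp: nc_interval_def partition_on_def)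

lemma nc_intervalD:
  assumes "P \<in> nc_interval a b"
  shows "finite P" and "\<Union>P = {a..<b}" and "\<And>V. V \<in> P \<Longrightarrow> V \<noteq> {}"
    and "\<And>V. V \<in> P \<Longrightarrow> V \<subseteq> {a..<b}"
    and "\<And>V W x. V \<in> P \<Longrightarrow> W \<in> P \<Longrightarrow> x \<in> V \<Longrightarrow> x \<in> W \<Longrightarrow> V = W"
    and "noncrossing P"
proof -
  have p: "partition_on {a..<b} P" and n: "noncrossing P"
    using assms by (auto simp: nc_interval_def)
  show "finite P" using p by (auto simp: partition_on_def intro: finite_UnionD)
  show "\<Union>P = {a..<b}" "\<And>V. V \<in> P \<Longrightarrow> V \<noteq> {}" "\<And>V. V \<in> P \<Longrightarrow> V \<subseteq> {a..<b}" "noncrossing P"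
    using p n by (auto simp: partition_on_def)
  show "V = W" if "V \<in> P" "W \<in> P" "x \<in> V" "x \<in> W" for V W x
    using p that by (auto simp: partition_on_def disjoint_def)
qed

lemma block_at_eq: "P \<in> nc_interval a b \<Longrightarrow> V \<in> P \<Longrightarrow> c \<in> V \<Longrightarrow> block_at c P = V"
  using nc_intervalD(5)[of P a b] unfolding block_at_def by blast

lemma block_at_mem:
  assumes "P \<in> nc_interval a b" "c \<in> {a..<b}"
  shows "block_at c P \<in> P" "c \<in> block_at c P"
proof -
  obtain V where "V \<in> P" "c \<in> V" using nc_intervalD(2)[OF assms(1)] assms(2) by blast
  with block_at_eq[OF assms(1)] show "block_at c P \<in> P" "c \<in> block_at c P" by auto
qed

text \<open>A crossing of two traces is a crossing of the blocks they come from, and distinct traces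
  come from distinct blocks.\<close>

lemma restrict_blocks_nc_interval:
  assumes "P \<in> nc_interval a b" "a \<le> c" "d \<le> b"
  shows "restrict_blocks {c..<d} P \<in> nc_interval c d"
proof -
  have "{c..<d} \<inter> {a..<b} = {c..<d}" using assms by auto
  then have "partition_on {c..<d} (restrict_blocks {c..<d} P)"
    using partition_on_restrict[of "{a..<b}" P "{c..<d}"] assms(1)
    by (simp add: nc_interval_def restrict_blocks_def)
  moreover have "noncrossing P" using assms by (simp add: nc_interval_def)
  then have "noncrossing (restrict_blocks {c..<d} P)"
    unfolding restrict_blocks_def noncrossing_def[of P]
    unfolding noncrossing_def
  proof (intro ballI impI notI)
    fix V W
    assume *: "\<forall>V\<in>P. \<forall>W\<in>P. V \<noteq> W \<longrightarrow>
        \<not> (\<exists>a\<in>V. \<exists>b\<in>W. \<exists>c\<in>V. \<exists>d\<in>W. a < b \<and> b < c \<and> c < d)"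
    assume "V \<in> (\<inter>) {c..<d} ` P - {{}}" "W \<in> (\<inter>) {c..<d} ` P - {{}}" "V \<noteq> W"
    then obtain V' W' where "V' \<in> P" "W' \<in> P" "V = {c..<d} \<inter> V'" "W = {c..<d} \<inter> W'" "V' \<noteq> W'"
      by blast
    moreover assume "\<exists>a\<in>V. \<exists>b\<in>W. \<exists>c\<in>V. \<exists>d\<in>W. a < b \<and> b < c \<and> c < d"
    then obtain a b c d where "a \<in> V" "b \<in> W" "c \<in> V" "d \<in> W" "a < b" "b < c" "c < d" by blast
    ultimately show False using * by blast
  qed
  ultimately show ?thesis by (simp add: nc_interval_def)
qed

text \<open>Blocks of \<open>Q\<close> lie strictly between \<open>a\<close> and \<open>p\<close>,
  where the enlarged block has no element. Since \<open>R\<close> lives on numbers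
  \<open>\<ge> p\<close>, a crossing of one of its blocks with the enlarged block that uses
  \<open>a\<close> remains one when \<open>p\<close> takes the place of \<open>a\<close>.\<close>

lemma nc_glue_nc_interval:
  assumes "a < b" "p \<in> {Suc a..b}" and Q: "Q \<in> nc_interval (Suc a) p" and R: "R \<in> nc_interval p b"
  shows "nc_glue a p Q R \<in> nc_interval a b"
proof -
  note q = nc_intervalD[OF Q] and r = nc_intervalD[OF R]
  have bp: "block_at p R \<subseteq> {p..<b}" using r(4) by (auto simp: block_at_def)
  have un: "\<Union>(nc_glue a p Q R) = {a..<b}"
  proof -
    have "\<Union>(nc_glue a p Q R) = insert a (\<Union>Q \<union> \<Union>R)"
      unfolding nc_glue_def block_at_def by blast
    also have "\<dots> = {a..<b}" using q(2) r(2) assms by auto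
    finally show ?thesis .
  qed
  have dj: "V = W" if "V \<in> nc_glue a p Q R" "W \<in> nc_glue a p Q R" "x \<in> V" "x \<in> W" for V W x
  proof -
    have QR: "V \<inter> W = {}" if "V \<in> Q" "W \<in> R" for V W
      using q(4)[OF that(1)] r(4)[OF that(2)] by fastforce
    have Q0: "V \<inter> insert a (block_at p R) = {}" if "V \<in> Q" for V
      using q(4)[OF that] bp by fastforce
    have R0: "V \<inter> insert a (block_at p R) = {}" if "V \<in> R" "p \<notin> V" for V
    proof -
      have "a \<notin> V" using r(4)[OF that(1)] assms(2) by fastforce
      moreover have "V \<inter> block_at p R = {}" using r(5) that unfolding block_at_def by blast
      ultimately show ?thesis by simp
    qed
    have "V = insert a (block_at p R) \<or> V \<in> Q \<or> V \<in> R \<and> p \<notin> V"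
      "W = insert a (block_at p R) \<or> W \<in> Q \<or> W \<in> R \<and> p \<notin> W"
      using that unfolding nc_glue_def by auto
    moreover have "V \<inter> W \<noteq> {}" "W \<inter> V \<noteq> {}" using that by auto
    ultimately show ?thesis
      using QR Q0 R0 q(5) r(5) that(3,4) by (elim disjE) metis+
  qed
  have nonempty: "{} \<notin> nc_glue a p Q R" using q(3) r(3) by (auto simp: nc_glue_def)
  have "noncrossing (nc_glue a p Q R)"
    unfolding noncrossing_def
  proof (intro ballI impI notI)
    fix V W
    assume V: "V \<in> nc_glue a p Q R" and W: "W \<in> nc_glue a p Q R" and "V \<noteq> W"
    assume "\<exists>x\<in>V. \<exists>y\<in>W. \<exists>z\<in>V. \<exists>w\<in>W. x < y \<and> y < z \<and> z < w"
    then obtain x y z w where m: "x \<in> V" "y \<in> W" "z \<in> V" "w \<in> W" "x < y" "y < z" "z < w" by blast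
    have Qb: "x \<in> {Suc a..<p}" if "x \<in> V" "V \<in> Q" for x V using q(4) that by blast
    have Rb: "x \<in> {p..<b}" if "x \<in> V" "V \<in> R" for x V using r(4) that by blast
    have Qn: False if "V \<in> Q" "W \<in> Q"
      using q(6) that m \<open>V \<noteq> W\<close> unfolding noncrossing_def by blast
    have Rn: False if "V \<in> R" "W \<in> R"
      using r(6) that m \<open>V \<noteq> W\<close> unfolding noncrossing_def by blast
    have Wa: "x \<ge> a" using m(1) V un by (metis UnionI atLeastLessThan_iff)
    \<comment> \<open>For \<open>p = b\<close> the set \<open>block_at p R\<close> is empty; having
      an element of it rules this case out.\<close>
    have bl: "block_at p R \<in> R \<and> p \<in> block_at p R" if "u \<in> block_at p R" for u
      using that r(2) bp block_at_mem[OF R, of p] assms(2)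
      by (metis atLeastLessThan_iff le_less_trans subsetD le_refl)
    consider "V \<in> Q" | "V \<in> R" "p \<notin> V" | "V = insert a (block_at p R)"
      using V unfolding nc_glue_def by blast
    then show False
    proof cases
      case 1
      then have "y \<in> {Suc a..<p}" using m Qb[of x V] Qb[of z V] by auto
      then have "W \<notin> R" "y \<notin> insert a (block_at p R)" using Rb[of y W] m bp assms(2) by auto
      then show False using W Qn 1 m(2) unfolding nc_glue_def by auto
    next
      case 2
      then have "y \<in> {p<..<b}" using m Rb[of x V] Rb[of z V] by auto
      then have "W \<notin> Q" "y \<noteq> a" using Qb[of y W] m assms(2) by auto
      moreover have "W \<notin> R" using Rn 2 by auto
      ultimately have W': "W = insert a (block_at p R)" "y \<in> block_at p R"
        using W m(2) unfolding nc_glue_def by auto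
      with bl have b: "block_at p R \<in> R" "p \<in> block_at p R" by auto
      have "w \<in> block_at p R" using W'(1) m Wa by auto
      moreover have "V \<noteq> block_at p R" using 2 b by blast
      ultimately show False
        using r(6) 2(1) b(1) m W'(2) unfolding noncrossing_def by blast
    next
      case 3
      then have z: "z \<in> block_at p R" using m Wa by auto
      with bl have b: "block_at p R \<in> R" "p \<in> block_at p R" by auto
      have zp: "p \<le> z" using bp z by auto
      then have "w \<in> {p..<b}" "w \<noteq> a" using m un W assms(2) by fastforce+
      then have "W \<notin> Q" using Qb[of w W] m by auto
      then have WR: "W \<in> R" "p \<notin> W" using W \<open>V \<noteq> W\<close> 3 unfolding nc_glue_def by auto
      \<comment> \<open>The element \<open>x\<close> may be \<open>a\<close>, which \<open>R\<close>
        does not cover. As \<open>p\<close> belongs to the same block and lies before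
        \<open>y\<close>, it replaces \<open>x\<close> in the crossing.\<close>
      then have "p < y" using Rb[of y W] m(2) by (metis atLeastLessThan_iff le_neq_implies_less)
      then show False
        using r(6) WR b m z unfolding noncrossing_def by blast
    qed
  qed
  moreover have "partition_on {a..<b} (nc_glue a p Q R)"
    using un nonempty dj unfolding partition_on_def disjoint_def by blast
  ultimately show ?thesis by (simp add: nc_interval_def)
qed

lemma restrict_blocks_left_nc_glue:
  assumes "a < b" "p \<in> {Suc a..b}" and Q: "Q \<in> nc_interval (Suc a) p" and R: "R \<in> nc_interval p b"
  shows "restrict_blocks {Suc a..<p} (nc_glue a p Q R) = Q"
proof -
  note q = nc_intervalD[OF Q] and r = nc_intervalD[OF R]
  have 1: "{Suc a..<p} \<inter> V = {}" if "V \<in> R" for V using r(4)[OF that] by fastforce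
  then have 2: "{Suc a..<p} \<inter> insert a (block_at p R) = {}" unfolding block_at_def by auto
  have 3: "{Suc a..<p} \<inter> V = V" if "V \<in> Q" for V using q(4)[OF that] by blast
  have e: "(\<inter>) {Suc a..<p} ` nc_glue a p Q R =
      insert {} ((\<inter>) {Suc a..<p} ` Q \<union> (\<inter>) {Suc a..<p} ` {V \<in> R. p \<notin> V})"
    unfolding nc_glue_def by (simp only: image_insert image_Un 2)
  have e': "(\<inter>) {Suc a..<p} ` Q = Q" using 3 by (auto simp: image_iff)
  have "(\<inter>) {Suc a..<p} ` {V \<in> R. p \<notin> V} \<subseteq> {{}}" using 1 by auto
  moreover have "{} \<notin> Q" using q(3) by blast
  ultimately show ?thesis unfolding restrict_blocks_def e e' by blast
qed

lemma restrict_blocks_right_nc_glue: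
  assumes "a < b" "p \<in> {Suc a..b}" and Q: "Q \<in> nc_interval (Suc a) p" and R: "R \<in> nc_interval p b"
  shows "restrict_blocks {p..<b} (nc_glue a p Q R) = R"
proof -
  note q = nc_intervalD[OF Q] and r = nc_intervalD[OF R]
  have 1: "{p..<b} \<inter> V = {}" if "V \<in> Q" for V using q(4)[OF that] by fastforce
  have 2: "{p..<b} \<inter> V = V" if "V \<in> R" for V using r(4)[OF that] by blast
  have 3: "{p..<b} \<inter> insert a (block_at p R) = block_at p R"
    using 2 assms(2) unfolding block_at_def by auto
  have 4: "V = block_at p R" if "V \<in> R" "p \<in> V" for V using block_at_eq[OF R that] by simp
  have 5: "block_at p R \<in> R" if "block_at p R \<noteq> {}"
    using that 4 unfolding block_at_def by blast
  have "(\<inter>) {p..<b} ` nc_glue a p Q R =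
      insert (block_at p R) ((\<inter>) {p..<b} ` Q \<union> (\<inter>) {p..<b} ` {V \<in> R. p \<notin> V})"
    unfolding nc_glue_def by (simp only: image_insert image_Un 3)
  also have "(\<inter>) {p..<b} ` {V \<in> R. p \<notin> V} = {V \<in> R. p \<notin> V}"
    using 2 by (auto simp: image_iff)
  finally show ?thesis
    unfolding restrict_blocks_def
  proof -
    assume e: "(\<inter>) {p..<b} ` nc_glue a p Q R =
      insert (block_at p R) ((\<inter>) {p..<b} ` Q \<union> {V \<in> R. p \<notin> V})"
    have "(\<inter>) {p..<b} ` Q \<subseteq> {{}}" using 1 by auto
    moreover have "{V \<in> R. p \<notin> V} \<union> ({block_at p R} - {{}}) = R"
      using 4 5 r(3) unfolding block_at_def by blast
    moreover have "{} \<notin> R" using r(3) by blast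
    ultimately show "(\<inter>) {p..<b} ` nc_glue a p Q R - {{}} = R" unfolding e by blast
  qed
qed

text \<open>Inserting \<open>b\<close> gives the default cut point \<open>b\<close> when the block
  of \<open>a\<close> is a singleton.\<close>

definition second_point :: "nat \<Rightarrow> nat \<Rightarrow> nat set set \<Rightarrow> nat" where
  "second_point a b P = Min (insert b (block_at a P - {a}))"

lemma second_point_nc_glue:
  assumes "a < b" "p \<in> {Suc a..b}" and Q: "Q \<in> nc_interval (Suc a) p" and R: "R \<in> nc_interval p b"
  shows "block_at a (nc_glue a p Q R) = insert a (block_at p R)"
    and "second_point a b (nc_glue a p Q R) = p"
proof -
  have bp: "block_at p R \<subseteq> {p..<b}" using nc_intervalD(4)[OF R] by (auto simp: block_at_def)
  show *: "block_at a (nc_glue a p Q R) = insert a (block_at p R)"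
    by (rule block_at_eq[OF nc_glue_nc_interval[OF assms]]) (auto simp: nc_glue_def)
  have "a \<notin> block_at p R" using bp assms by auto
  then have "second_point a b (nc_glue a p Q R) = Min (insert b (block_at p R))"
    unfolding second_point_def * by simp
  also have "\<dots> = p"
  proof (rule Min_eqI)
    show "finite (insert b (block_at p R))" using bp finite_subset by blast
    show "p \<in> insert b (block_at p R)"
      using block_at_mem(2)[OF R, of p] assms(2) by (cases "p = b") auto
  qed (use bp assms in auto)
  finally show "second_point a b (nc_glue a p Q R) = p" .
qed

lemma second_point_bounds:
  assumes "a < b" and P: "P \<in> nc_interval a b"
  shows "second_point a b P \<in> {Suc a..b}"
proof -
  have sub: "block_at a P \<subseteq> {a..<b}"
    using nc_intervalD(4)[OF P] block_at_mem[OF P, of a] assms by auto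
  then have fin: "finite (insert b (block_at a P - {a}))" by (auto intro: finite_subset)
  show ?thesis unfolding second_point_def using fin Min_in[OF fin] sub assms by fastforce
qed

text \<open>No block other than that of \<open>a\<close> has elements on both sides of
  \<open>p\<close>: if \<open>p < b\<close>, then \<open>a\<close> and \<open>p\<close> lie in one
  block, which such a block would cross. So each remaining block survives in exactly one of the two
  restrictions, and the block of \<open>a\<close> leaves its part from \<open>p\<close> on in the
  right one.\<close>

lemma nc_glue_restrict_blocks:
  assumes ab: "a < b" and P: "P \<in> nc_interval a b"
  defines "p \<equiv> second_point a b P"
  shows "nc_glue a p (restrict_blocks {Suc a..<p} P) (restrict_blocks {p..<b} P) = P"
proof -
  note D = nc_intervalD[OF P]
  define V0 where "V0 = block_at a P"
  have V0: "V0 \<in> P" "a \<in> V0" using block_at_mem[OF P, of a] ab by (auto simp: V0_def)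
  have V0s: "V0 \<subseteq> {a..<b}" using D(4) V0 by auto
  have fin: "finite (insert b (V0 - {a}))" using V0s by (auto intro: finite_subset)
  have pm: "p = Min (insert b (V0 - {a}))" by (simp add: p_def second_point_def V0_def)
  have pin: "p \<in> insert b (V0 - {a})" unfolding pm by (rule Min_in[OF fin]) simp
  have pb: "p \<in> {Suc a..b}" unfolding p_def by (rule second_point_bounds[OF ab P])
  have ple: "p \<le> c" if "c \<in> V0" "c \<noteq> a" for c unfolding pm using fin that by (intro Min_le) auto
  have V0p: "{p..<b} \<inter> V0 = V0 - {a}" "{Suc a..<p} \<inter> V0 = {}"
    using V0s pb ple by fastforce+
  have dich: "V \<subseteq> {Suc a..<p} \<or> V \<subseteq> {p<..<b}" if V: "V \<in> P" "V \<noteq> V0" for V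
  proof (cases "p = b")
    case True
    have "a \<notin> V" using D(5) V V0 by blast
    then show ?thesis using D(4)[OF V(1)] True by (fastforce simp: Suc_le_eq order.strict_iff_order)
  next
    case False
    then have pV: "p \<in> V0" using pin by auto
    have na: "a \<notin> V" "p \<notin> V" using D(5) V V0 pV by blast+
    have sub: "V \<subseteq> {a<..<b} - {p}"
      using D(4)[OF V(1)] na by (fastforce simp: order.strict_iff_order)
    have "\<not> (\<exists>d\<in>V. \<exists>e\<in>V. d < p \<and> p < e)"
    proof
      assume "\<exists>d\<in>V. \<exists>e\<in>V. d < p \<and> p < e"
      then obtain d e where de: "d \<in> V" "e \<in> V" "d < p" "p < e" by blast
      with sub have "a < d" by auto
      with de show False using D(6) V0 V pV unfolding noncrossing_def by blast
    qed
    then have "(\<forall>c\<in>V. c \<le> p) \<or> (\<forall>c\<in>V. p \<le> c)" by (meson not_le)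
    then show ?thesis
    proof
      assume "\<forall>c\<in>V. c \<le> p"
      then have "V \<subseteq> {Suc a..<p}" using sub by (fastforce simp: order.strict_iff_order)
      then show ?thesis ..
    next
      assume "\<forall>c\<in>V. p \<le> c"
      then have "V \<subseteq> {p<..<b}" using sub by (fastforce simp: order.strict_iff_order)
      then show ?thesis ..
    qed
  qed
  have rV: "{p..<b} \<inter> V = {} \<and> {Suc a..<p} \<inter> V = V \<or>
      {p..<b} \<inter> V = V \<and> {Suc a..<p} \<inter> V = {} \<and> p \<notin> V"
    if V: "V \<in> P" "V \<noteq> V0" for V
    using dich[OF V] by fastforce
  have R: "restrict_blocks {p..<b} P \<in> nc_interval p b"
    using restrict_blocks_nc_interval[OF P] pb by auto
  have bR: "block_at p (restrict_blocks {p..<b} P) = V0 - {a}"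
  proof (cases "p = b")
    case True
    then have "V0 - {a} = {}" using V0p by auto
    moreover have "block_at p (restrict_blocks {p..<b} P) = {}"
      using True by (auto simp: block_at_def restrict_blocks_def)
    ultimately show ?thesis by simp
  next
    case False
    then have "p \<in> V0 - {a}" using pin by auto
    moreover from this have "V0 - {a} \<in> restrict_blocks {p..<b} P"
      unfolding restrict_blocks_def V0p(1)[symmetric] using V0(1) by blast
    ultimately show ?thesis using block_at_eq[OF R] by blast
  qed
  have 1: "insert a (V0 - {a}) = V0" using V0 by auto
  have 2: "restrict_blocks {Suc a..<p} P \<union> {V \<in> restrict_blocks {p..<b} P. p \<notin> V} \<union> {V0} = P"
    (is "?A \<union> ?B \<union> _ = _")
  proof (intro equalityI subsetI)
    fix V assume "V \<in> ?A \<union> ?B \<union> {V0}"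
    then consider "V = V0" | W where "W \<in> P" "V = {Suc a..<p} \<inter> W" "V \<noteq> {}"
      | W where "W \<in> P" "V = {p..<b} \<inter> W" "V \<noteq> {}" "p \<notin> V"
      unfolding restrict_blocks_def by blast
    then show "V \<in> P"
    proof cases
      case 1 then show ?thesis using V0 by simp
    next
      case (2 W) then show ?thesis using rV[of W] V0p by (cases "W = V0") auto
    next
      case (3 W)
      show ?thesis
      proof (cases "W = V0")
        case True
        then have "V = V0 - {a}" using 3 V0p by auto
        then have "p = b" using 3 pin by auto
        then show ?thesis using 3 by auto
      next
        case False then show ?thesis using rV[of W] 3 by auto
      qed
    qed
  next
    fix V assume V: "V \<in> P"
    show "V \<in> ?A \<union> ?B \<union> {V0}"
    proof (cases "V = V0")
      case False
      then show ?thesis using rV[OF V] D(3)[OF V] V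
        unfolding restrict_blocks_def by (auto simp: image_iff)
    qed simp
  qed
  show ?thesis unfolding nc_glue_def bR 1 using 2 by blast
qed

lemma bij_betw_nc_glue:
  assumes "a < b"
  shows "bij_betw (\<lambda>(p, Q, R). nc_glue a p Q R)
    (SIGMA p:{Suc a..b}. nc_interval (Suc a) p \<times> nc_interval p b) (nc_interval a b)"
    (is "bij_betw ?g ?S ?T")
proof -
  define f where "f P = (second_point a b P, restrict_blocks {Suc a..<second_point a b P} P,
    restrict_blocks {second_point a b P..<b} P)" for P
  have g: "f (?g x) = x \<and> ?g x \<in> ?T" if x: "x \<in> ?S" for x
  proof -
    obtain p Q R where x_eq: "x = (p, Q, R)" by (cases x)
    have *: "p \<in> {Suc a..b}" "Q \<in> nc_interval (Suc a) p" "R \<in> nc_interval p b"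
      using x unfolding x_eq by blast+
    show ?thesis
      using second_point_nc_glue(2)[OF assms *] restrict_blocks_left_nc_glue[OF assms *]
        restrict_blocks_right_nc_glue[OF assms *] nc_glue_nc_interval[OF assms *]
      by (simp add: f_def x_eq)
  qed
  have f: "?g (f P) = P \<and> f P \<in> ?S" if P: "P \<in> ?T" for P
  proof -
    have p: "second_point a b P \<in> {Suc a..b}" by (rule second_point_bounds[OF assms P])
    have "restrict_blocks {Suc a..<second_point a b P} P \<in> nc_interval (Suc a) (second_point a b P)"
      by (rule restrict_blocks_nc_interval[OF P]) (use p in auto)
    moreover have "restrict_blocks {second_point a b P..<b} P \<in> nc_interval (second_point a b P) b"
      by (rule restrict_blocks_nc_interval[OF P]) (use p in auto)
    ultimately show ?thesis using p nc_glue_restrict_blocks[OF assms P] by (simp add: f_def)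
  qed
  show ?thesis
  proof (rule bij_betw_byWitness[where f' = f])
    show "\<forall>x\<in>?S. f (?g x) = x" by (rule ballI, rule g[THEN conjunct1])
    show "\<forall>P\<in>?T. ?g (f P) = P" by (rule ballI, rule f[THEN conjunct1])
    show "?g ` ?S \<subseteq> ?T" by (rule image_subsetI, rule g[THEN conjunct2])
    show "f ` ?T \<subseteq> ?S" by (rule image_subsetI, rule f[THEN conjunct2])
  qed
qed

section \<open>Generating functions of cumulant-weighted sums over noncrossing partitions\<close>

context
  fixes \<kappa> :: "nat \<Rightarrow> 'b::comm_ring_1"
begin

definition nc_sum :: "nat \<Rightarrow> nat \<Rightarrow> 'b" where
  "nc_sum a b = (\<Sum>P\<in>nc_interval a b. \<Prod>V\<in>P. \<kappa> (card V))"

text \<open>The block of \<open>a\<close> counts as having \<open>j\<close> further elements. These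
  are the ones cut off in earlier steps of the recursion, which must remember the full size of a
  block until its last element is reached.\<close>

definition marked_weight :: "nat \<Rightarrow> nat \<Rightarrow> nat set set \<Rightarrow> 'b" where
  "marked_weight j a P = \<kappa> (card (block_at a P) + j) * (\<Prod>V\<in>{V\<in>P. a \<notin> V}. \<kappa> (card V))"

definition marked_sum :: "nat \<Rightarrow> nat \<Rightarrow> nat \<Rightarrow> 'b" where
  "marked_sum j a b = (\<Sum>P\<in>nc_interval a b. marked_weight j a P)"

text \<open>Nothing is left of the block except the \<open>j\<close> elements cut off before; this
  ends the recursion when the cut point is \<open>b\<close>.\<close>

lemma marked_sum_empty: "marked_sum j a a = \<kappa> j"
  by (simp add: marked_sum_def marked_weight_def block_at_def)

lemma nc_sum_eq_marked_sum:
  assumes "a < b"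
  shows "nc_sum a b = marked_sum 0 a b"
  unfolding nc_sum_def marked_sum_def
proof (rule sum.cong[OF refl])
  fix P assume P: "P \<in> nc_interval a b"
  note D = nc_intervalD[OF P]
  have m: "block_at a P \<in> P" "a \<in> block_at a P" using block_at_mem[OF P] assms by auto
  have "V = block_at a P" if "V \<in> P" "a \<in> V" for V using block_at_eq[OF P that] by simp
  then have "P - {block_at a P} = {V\<in>P. a \<notin> V}" using m by blast
  then show "(\<Prod>V\<in>P. \<kappa> (card V)) = marked_weight 0 a P"
    using prod.remove[OF D(1) m(1), of "\<lambda>V. \<kappa> (card V)"] by (simp add: marked_weight_def)
qed

text \<open>Gluing adds the single element \<open>a\<close> to the block of \<open>p\<close>, which
  raises \<open>j\<close> by one; the blocks of \<open>Q\<close> contribute an independent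
  factor.\<close>

lemma marked_weight_nc_glue:
  assumes "a < b" "p \<in> {Suc a..b}" and Q: "Q \<in> nc_interval (Suc a) p" and R: "R \<in> nc_interval p b"
  shows "marked_weight j a (nc_glue a p Q R) = (\<Prod>V\<in>Q. \<kappa> (card V)) * marked_weight (Suc j) p R"
proof -
  note q = nc_intervalD[OF Q] and r = nc_intervalD[OF R]
  have bp: "block_at p R \<subseteq> {p..<b}" using r(4) by (auto simp: block_at_def)
  then have fin: "finite (block_at p R)" by (auto intro: finite_subset)
  have na: "a \<notin> block_at p R" using bp assms by auto
  have "a \<notin> V" if "V \<in> Q \<or> V \<in> R" for V using that q(4) r(4) assms(2) by fastforce
  then have set: "{V \<in> nc_glue a p Q R. a \<notin> V} = Q \<union> {V\<in>R. p \<notin> V}"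
    by (auto simp: nc_glue_def)
  have dj: "Q \<inter> {V\<in>R. p \<notin> V} = {}"
  proof (rule ccontr)
    assume "Q \<inter> {V\<in>R. p \<notin> V} \<noteq> {}"
    then obtain V where V: "V \<in> Q" "V \<in> R" by blast
    then obtain c where "c \<in> V" using q(3) by blast
    then show False using V q(4) r(4) by fastforce
  qed
  show ?thesis
    unfolding marked_weight_def set second_point_nc_glue(1)[OF assms]
    using fin na dj q(1) r(1) by (simp add: prod.union_disjoint mult_ac)
qed

lemma marked_sum_rec:
  assumes "a < b"
  shows "marked_sum j a b = (\<Sum>p\<in>{Suc a..b}. nc_sum (Suc a) p * marked_sum (Suc j) p b)"
proof -
  let ?S = "SIGMA p:{Suc a..b}. nc_interval (Suc a) p \<times> nc_interval p b"
  have "marked_sum j a b = (\<Sum>x\<in>?S. marked_weight j a (case x of (p, Q, R) \<Rightarrow> nc_glue a p Q R))"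
    unfolding marked_sum_def
    by (rule sum.reindex_bij_betw[OF bij_betw_nc_glue[OF assms], symmetric])
  also have "\<dots> = (\<Sum>(p, Q, R)\<in>?S. (\<Prod>V\<in>Q. \<kappa> (card V)) * marked_weight (Suc j) p R)"
  proof (rule sum.cong[OF refl], clarify)
    fix p Q R assume "p \<in> {Suc a..b}" "Q \<in> nc_interval (Suc a) p" "R \<in> nc_interval p b"
    from marked_weight_nc_glue[OF assms this]
    show "marked_weight j a (nc_glue a p Q R) = (\<Prod>V\<in>Q. \<kappa> (card V)) * marked_weight (Suc j) p R" .
  qed
  also have "\<dots> = (\<Sum>p\<in>{Suc a..b}. \<Sum>(Q, R)\<in>nc_interval (Suc a) p \<times> nc_interval p b.
      (\<Prod>V\<in>Q. \<kappa> (card V)) * marked_weight (Suc j) p R)"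
    by (subst sum.Sigma) auto
  also have "\<dots> = (\<Sum>p\<in>{Suc a..b}. nc_sum (Suc a) p * marked_sum (Suc j) p b)"
    by (simp add: nc_sum_def marked_sum_def sum_product sum.cartesian_product)
  finally show ?thesis .
qed

text \<open>The recursion sees only lengths of intervals, so induction on the length avoids
  transporting partitions along a shift. It mixes both kinds of sums and raises \<open>j\<close>,
  hence the joint statement for all \<open>j\<close>.\<close>

lemma nc_sum_translate_aux:
  "nc_sum a (a + n) = nc_sum 0 n \<and> (\<forall>j. marked_sum j a (a + n) = marked_sum j 0 n)"
proof (induction n arbitrary: a rule: less_induct)
  case (less n)
  show ?case
  proof (cases n)
    case 0
    then show ?thesis by (simp add: marked_sum_empty) (simp add: nc_sum_def)
  next
    case (Suc k)
    have m: "marked_sum j a (a + n) = marked_sum j 0 n" for j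
    proof -
      have *: "marked_sum j a (a + n) =
        (\<Sum>i\<le>k. nc_sum 0 i * marked_sum (Suc j) 0 (k - i))" for a
      proof -
        have "marked_sum j a (a + n) =
          (\<Sum>p\<in>{Suc a..a + n}. nc_sum (Suc a) p * marked_sum (Suc j) p (a + n))"
          using Suc by (intro marked_sum_rec) simp
        also have "\<dots> = (\<Sum>i\<le>k. nc_sum (Suc a) (Suc a + i) * marked_sum (Suc j) (Suc a + i) (a + n))"
          by (rule sum.reindex_bij_witness[of _ "\<lambda>i. Suc a + i" "\<lambda>p. p - Suc a"]) (use Suc in auto)
        also have "\<dots> = (\<Sum>i\<le>k. nc_sum 0 i * marked_sum (Suc j) 0 (k - i))"
        proof (rule sum.cong[OF refl])
          fix i assume "i \<in> {..k}"
          then have e: "a + n = (Suc a + i) + (k - i)" "i < n" "k - i < n" using Suc by auto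
          show "nc_sum (Suc a) (Suc a + i) * marked_sum (Suc j) (Suc a + i) (a + n) =
            nc_sum 0 i * marked_sum (Suc j) 0 (k - i)"
            unfolding e(1) using less[of i "Suc a"] less[of "k - i" "Suc a + i"] e(2,3) by simp
        qed
        finally show ?thesis .
      qed
      show ?thesis using *[of a] *[of 0] by simp
    qed
    moreover have "nc_sum a (a + n) = nc_sum 0 n"
      using m[of 0] nc_sum_eq_marked_sum[of a "a + n"] nc_sum_eq_marked_sum[of 0 n] Suc by simp
    ultimately show ?thesis by blast
  qed
qed

lemma marked_sum_Suc:
  "marked_sum j 0 (Suc n) = (\<Sum>i\<le>n. nc_sum 0 i * marked_sum (Suc j) 0 (n - i))"
proof -
  have "marked_sum j 0 (Suc n) =
      (\<Sum>p\<in>{Suc 0..Suc n}. nc_sum (Suc 0) p * marked_sum (Suc j) p (Suc n))"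
    by (intro marked_sum_rec) simp
  also have "\<dots> = (\<Sum>i\<le>n. nc_sum (Suc 0) (Suc 0 + i) * marked_sum (Suc j) (Suc i) (Suc i + (n - i)))"
    by (rule sum.reindex_bij_witness[of _ "\<lambda>i. Suc i" "\<lambda>p. p - 1"]) auto
  finally show ?thesis by (simp only: nc_sum_translate_aux)
qed

text \<open>Write \<open>t\<close> for \<open>fps_X\<close>. The recursion reads
  \<open>H j = \<kappa> j + t F * H (Suc j)\<close> for the series \<open>H j\<close> of the marked
  sums, and \<open>F = H 0\<close> because of \<open>\<kappa> 0 = 1\<close>. Iteration yields the
  sum of all \<open>\<kappa> i * (t F)^i\<close>.\<close>

lemma nc_sum_fps_compose:
  assumes "\<kappa> 0 = 1"
  shows "Abs_fps \<kappa> oo (fps_X * Abs_fps (nc_sum 0)) = Abs_fps (nc_sum 0)"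
proof -
  define F where "F = Abs_fps (nc_sum 0)"
  define H where "H j = Abs_fps (marked_sum j 0)" for j
  have H: "H j = fps_const (\<kappa> j) + (fps_X * F) * H (Suc j)" for j
  proof (rule fps_ext)
    fix n
    show "H j $ n = (fps_const (\<kappa> j) + (fps_X * F) * H (Suc j)) $ n"
    proof (cases n)
      case 0 then show ?thesis by (simp add: H_def marked_sum_empty)
    next
      case (Suc k)
      have "((fps_X * F) * H (Suc j)) $ Suc k = (F * H (Suc j)) $ k"
        by (simp add: mult.assoc)
      then show ?thesis
        by (simp add: Suc H_def F_def fps_mult_nth marked_sum_Suc atLeast0AtMost)
    qed
  qed
  have F0: "F = H 0"
  proof (rule fps_ext)
    fix n show "F $ n = H 0 $ n"
    proof (cases n)
      case 0
      have "nc_sum 0 0 = 1" by (simp add: nc_sum_def)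
      then show ?thesis by (simp add: 0 F_def H_def marked_sum_empty assms)
    next
      case (Suc k)
      then show ?thesis by (simp add: F_def H_def nc_sum_eq_marked_sum)
    qed
  qed
  have ex: "H 0 = (\<Sum>i<N. fps_const (\<kappa> i) * (fps_X * F) ^ i) + (fps_X * F) ^ N * H N" for N
  proof (induction N)
    case (Suc N)
    have "(fps_X * F) ^ N * H N = fps_const (\<kappa> N) * (fps_X * F) ^ N + (fps_X * F) ^ Suc N * H (Suc N)"
      by (subst H[of N]) (simp add: distrib_left mult_ac)
    then show ?case using Suc by (simp add: add.assoc)
  qed simp
  have "(Abs_fps \<kappa> oo (fps_X * F)) $ n = F $ n" for n
  proof -
    \<comment> \<open>The remainder after \<open>n + 1\<close> iterations is divisible by
      \<open>t^(n+1)\<close> and does not reach coefficient \<open>n\<close>.\<close>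
    have "((fps_X * F) ^ Suc n * H (Suc n)) $ n = 0"
      unfolding power_mult_distrib mult.assoc by (subst fps_X_power_mult_nth) simp
    then have "H 0 $ n = (\<Sum>i<Suc n. fps_const (\<kappa> i) * (fps_X * F) ^ i) $ n"
      by (subst ex[of "Suc n"]) simp
    also have "\<dots> = (Abs_fps \<kappa> oo (fps_X * F)) $ n"
      by (simp add: fps_compose_nth fps_sum_nth lessThan_Suc_atMost atLeast0AtMost)
    finally show ?thesis using F0 by simp
  qed
  then show ?thesis unfolding F_def by (rule fps_ext)
qed

end

text \<open>The constant term is set to 1, as the functional equation below requires; the recursive
  definition would give \<open>m 0 - 1\<close> at index 0.\<close>

definition cumulant_fps :: "(nat \<Rightarrow> 'b::comm_ring_1) \<Rightarrow> 'b fps" where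
  "cumulant_fps m = Abs_fps (\<lambda>n. if n = 0 then 1 else free_cumulant m n)"

text \<open>This is the functional equation \<open>C(t M(t)) = M(t)\<close> between moment and
  cumulant series. Blocks are nonempty, so changing the cumulant of index 0 does not affect the
  moment-cumulant formula.\<close>

lemma moment_cumulant_fps:
  fixes m :: "nat \<Rightarrow> 'b::comm_ring_1"
  assumes "m 0 = 1"
  shows "cumulant_fps m oo (fps_X * Abs_fps m) = Abs_fps m"
proof -
  define \<kappa> where "\<kappa> n = (if n = 0 then 1 else free_cumulant m n)" for n
  have "nc_sum \<kappa> 0 n = m n" for n
  proof (cases "n = 0")
    case True then show ?thesis using assms by (simp add: nc_sum_def)
  next
    case False
    have "nc_sum \<kappa> 0 n = (\<Sum>P\<in>NC n. \<Prod>V\<in>P. free_cumulant m (card V))"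
      unfolding nc_sum_def NC_eq_nc_interval
    proof (intro sum.cong prod.cong refl)
      fix P V assume "P \<in> nc_interval 0 n" "V \<in> P"
      then have "V \<noteq> {}" "V \<subseteq> {0..<n}" using nc_intervalD(3,4)[of P 0 n V] by auto
      then have "V \<noteq> {}" "finite V" by (auto intro: finite_subset)
      then show "\<kappa> (card V) = free_cumulant m (card V)" by (auto simp: \<kappa>_def)
    qed
    then show ?thesis using moment_free_cumulant[of n m] False by simp
  qed
  then have "nc_sum \<kappa> 0 = m" by auto
  moreover have "Abs_fps \<kappa> = cumulant_fps m" by (simp add: \<kappa>_def[abs_def] cumulant_fps_def)
  ultimately show ?thesis using nc_sum_fps_compose[of \<kappa>] by (simp add: \<kappa>_def)
qed

section \<open>Moment and cumulant series\<close>

lemma fps_eq_0_if_X_power_dvd: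
  fixes f :: "'b::comm_ring_1 fps"
  assumes "\<And>m. fps_X ^ m dvd f"
  shows "f = 0"
proof (rule fps_ext)
  fix n
  obtain g where "f = fps_X ^ Suc n * g" using assms[of "Suc n"] by (elim dvdE)
  then show "f $ n = 0 $ n" by (simp only: fps_X_power_mult_nth) simp
qed

lemma fps_X_compose_eq:
  fixes f :: "'b::comm_ring_1 fps"
  assumes "f $ 0 = 0"
  shows "fps_X oo f = f"
  using assms by (simp add: fps_X_fps_compose fps_eq_iff)

text \<open>The difference of two solutions is \<open>t^2\<close> times a combination of such
  differences, so it is divisible by every power of \<open>t\<close>. The equation for
  \<open>k\<close> involves the indices \<open>k + 1\<close> and \<open>k + 2\<close>; the induction
  therefore treats all \<open>k\<close> at once.\<close>

lemma fps_quadratic_system_unique: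
  fixes P Q :: "nat \<Rightarrow> 'b::comm_ring_1 fps"
  assumes P: "\<And>k. P k = c k + fps_X\<^sup>2 * (d * (P 2 * P k - 2 * (P 1 * P (Suc k)) + P 0 * P (Suc (Suc k))))"
    and Q: "\<And>k. Q k = c k + fps_X\<^sup>2 * (d * (Q 2 * Q k - 2 * (Q 1 * Q (Suc k)) + Q 0 * Q (Suc (Suc k))))"
  shows "P k = Q k"
proof -
  have "\<forall>k. fps_X ^ m dvd P k - Q k" for m
  proof (induction m)
    case (Suc m)
    show ?case
    proof
      fix k
      let ?D = "\<lambda>k. P k - Q k"
      have "?D k = fps_X\<^sup>2 * (d * (P 2 * P k - 2 * (P 1 * P (Suc k)) + P 0 * P (Suc (Suc k)))) -
          fps_X\<^sup>2 * (d * (Q 2 * Q k - 2 * (Q 1 * Q (Suc k)) + Q 0 * Q (Suc (Suc k))))"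
        by (subst P, subst Q) (simp only: add_diff_cancel_left)
      also have "\<dots> = fps_X\<^sup>2 * (d * (?D 2 * P k + Q 2 * ?D k
          - 2 * (?D 1 * P (Suc k) + Q 1 * ?D (Suc k))
          + (?D 0 * P (Suc (Suc k)) + Q 0 * ?D (Suc (Suc k)))))"
        by (simp add: algebra_simps)
      finally have "?D k = fps_X\<^sup>2 * (d * (?D 2 * P k + Q 2 * ?D k
          - 2 * (?D 1 * P (Suc k) + Q 1 * ?D (Suc k))
          + (?D 0 * P (Suc (Suc k)) + Q 0 * ?D (Suc (Suc k)))))" .
      moreover have "fps_X ^ m dvd d * (?D 2 * P k + Q 2 * ?D k
          - 2 * (?D 1 * P (Suc k) + Q 1 * ?D (Suc k))
          + (?D 0 * P (Suc (Suc k)) + Q 0 * ?D (Suc (Suc k))))"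
      proof -
        have D: "fps_X ^ m dvd ?D j" for j using Suc by blast
        show ?thesis
          using dvd_add[OF dvd_mult2[OF D[of 2], of "P k"] dvd_mult[OF D[of k], of "Q 2"]]
            dvd_add[OF dvd_mult2[OF D[of 1], of "P (Suc k)"] dvd_mult[OF D[of "Suc k"], of "Q 1"]]
            dvd_add[OF dvd_mult2[OF D[of 0], of "P (Suc (Suc k))"] dvd_mult[OF D[of "Suc (Suc k)"], of "Q 0"]]
          by (intro dvd_mult) (blast intro: dvd_add[OF dvd_diff[OF _ dvd_mult]])
      qed
      ultimately have "fps_X\<^sup>2 * fps_X ^ m dvd ?D k" by (metis dvd_refl mult_dvd_mono)
      then show "fps_X ^ Suc m dvd ?D k"
        by (rule dvd_trans[rotated]) (simp add: power2_eq_square mult.assoc)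
    qed
  qed simp
  then have "P k - Q k = 0" by (intro fps_eq_0_if_X_power_dvd) blast
  then show ?thesis by simp
qed

text \<open>In the application \<open>F k\<close> and \<open>G k\<close> are the series of
  \<open>\<tau>(x^k y^n)\<close> and \<open>\<tau>(x^k (s + y)^n)\<close> in \<open>n\<close>, and
  \<open>c k\<close> is \<open>\<tau>(x^k)\<close>. The only difference between the systems is the
  term \<open>G 0 * G k\<close>. Moving it to the left and dividing by \<open>b\<close> gives the
  same system that the rescaled series \<open>H k\<close> satisfy.\<close>

lemma cumulant_fps_add_from_system:
  fixes F G :: "nat \<Rightarrow> 'b::field fps"
  assumes F: "\<And>k. F k = fps_const (c k) + fps_const v * fps_X\<^sup>2 *
      (F 2 * F k - 2 * (F 1 * F (Suc k)) + F 0 * F (Suc (Suc k)))"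
    and G: "\<And>k. G k = fps_const (c k) + fps_const v * fps_X\<^sup>2 *
      (G 0 * G k + (G 2 * G k - 2 * (G 1 * G (Suc k)) + G 0 * G (Suc (Suc k))))"
    and c0: "c 0 = 1"
    and CF: "CF oo (fps_X * F 0) = F 0" and CG: "CG oo (fps_X * G 0) = G 0"
  shows "CG = CF + fps_const v * fps_X\<^sup>2"
proof -
  define b where "b = 1 - fps_const v * fps_X\<^sup>2 * G 0"
  define a where "a = inverse b"
  have b0: "b $ 0 = 1" by (simp add: b_def)
  have ab: "a * b = 1" unfolding a_def using b0 by (intro inverse_mult_eq_1) simp
  define u where "u = fps_X * a"
  have u0: "u $ 0 = 0" by (simp add: u_def)
  have X: "fps_X oo u = u" by (rule fps_X_compose_eq[OF u0])
  define H where "H k = a * (F k oo u)" for k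
  define d where "d = fps_const v * a"
  have Geq: "G k = a * fps_const (c k) +
      fps_X\<^sup>2 * (d * (G 2 * G k - 2 * (G 1 * G (Suc k)) + G 0 * G (Suc (Suc k))))" for k
  proof -
    have "b * G k = fps_const (c k) +
        fps_const v * fps_X\<^sup>2 * (G 2 * G k - 2 * (G 1 * G (Suc k)) + G 0 * G (Suc (Suc k)))"
    proof -
      have *: "x - r * y = z + r * w" if "x = z + r * (y + w)" for x y z w r :: "'b fps"
        unfolding that by (simp add: algebra_simps)
      have "b * G k = G k - fps_const v * fps_X\<^sup>2 * (G 0 * G k)"
        by (simp add: b_def algebra_simps)
      also have "\<dots> = fps_const (c k) + fps_const v * fps_X\<^sup>2 *
          (G 2 * G k - 2 * (G 1 * G (Suc k)) + G 0 * G (Suc (Suc k)))"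
        by (rule *[OF G])
      finally show ?thesis .
    qed
    then have "a * (b * G k) = a * (fps_const (c k) +
        fps_const v * fps_X\<^sup>2 * (G 2 * G k - 2 * (G 1 * G (Suc k)) + G 0 * G (Suc (Suc k))))"
      by simp
    moreover have "a * (b * G k) = G k" using ab by (simp add: mult.assoc[symmetric])
    ultimately show ?thesis unfolding d_def distrib_left by (simp only: mult_ac)
  qed
  have Heq: "H k = a * fps_const (c k) +
      fps_X\<^sup>2 * (d * (H 2 * H k - 2 * (H 1 * H (Suc k)) + H 0 * H (Suc (Suc k))))" for k
  proof -
    have two: "(2 :: 'b fps) oo u = 2"
      by (metis fps_compose_add_distrib fps_compose_1 one_add_one)
    have "F k oo u = fps_const (c k) + fps_const v * u\<^sup>2 * ((F 2 oo u) * (F k oo u)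
        - 2 * ((F 1 oo u) * (F (Suc k) oo u)) + (F 0 oo u) * (F (Suc (Suc k)) oo u))"
      by (subst F) (simp add: fps_compose_add_distrib fps_compose_sub_distrib
          fps_compose_mult_distrib[OF u0] two power2_eq_square X)
    then have "H k = a * (fps_const (c k) + fps_const v * u\<^sup>2 * ((F 2 oo u) * (F k oo u)
        - 2 * ((F 1 oo u) * (F (Suc k) oo u)) + (F 0 oo u) * (F (Suc (Suc k)) oo u)))"
      unfolding H_def by (rule arg_cong)
    also have "\<dots> = a * fps_const (c k) + a * (fps_const v * u\<^sup>2 * ((F 2 oo u) * (F k oo u)
        - 2 * ((F 1 oo u) * (F (Suc k) oo u)) + (F 0 oo u) * (F (Suc (Suc k)) oo u)))"
      by (rule distrib_left)
    also have "a * (fps_const v * u\<^sup>2 * ((F 2 oo u) * (F k oo u)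
        - 2 * ((F 1 oo u) * (F (Suc k) oo u)) + (F 0 oo u) * (F (Suc (Suc k)) oo u))) =
      fps_X\<^sup>2 * (d * (H 2 * H k - 2 * (H 1 * H (Suc k)) + H 0 * H (Suc (Suc k))))"
      unfolding H_def d_def u_def by (simp add: algebra_simps power2_eq_square)
    finally show ?thesis .
  qed
  have HG: "H 0 = G 0" by (rule fps_quadratic_system_unique[OF Heq Geq])
  have XF: "(fps_X * F 0) oo u = fps_X * G 0"
  proof -
    have "(fps_X * F 0) oo u = u * (F 0 oo u)" by (simp add: fps_compose_mult_distrib[OF u0] X)
    also have "\<dots> = fps_X * H 0" by (simp add: u_def H_def mult.assoc)
    finally show ?thesis by (simp add: HG)
  qed
  have G00: "G 0 $ 0 = 1"
    by (subst G) (simp add: c0 power2_eq_square mult.assoc)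
  define w where "w = fps_X * G 0"
  have w0: "w $ 0 = 0" and w1: "w $ 1 \<noteq> 0" by (auto simp: w_def G00)
  \<comment> \<open>Since \<open>t F 0\<close> becomes \<open>w = t G 0\<close> under the
    substitution, \<open>CF(w)\<close> equals \<open>b * G 0 = G 0 - v w^2\<close>. Hence
    \<open>CF + v t^2\<close> and \<open>CG\<close> agree after composition with \<open>w\<close>,
    which is injective because \<open>w\<close> has order exactly one.\<close>
  have "CF oo w = F 0 oo u"
    unfolding w_def XF[symmetric] by (subst fps_compose_assoc) (use u0 CF in simp_all)
  also have "\<dots> = b * (a * (F 0 oo u))" using ab by (simp add: mult.assoc[symmetric] mult.commute)
  also have "\<dots> = b * G 0" using HG by (simp add: H_def)
  finally have "(CF + fps_const v * fps_X\<^sup>2) oo w = b * G 0 + fps_const v * w\<^sup>2"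
    by (simp add: fps_compose_add_distrib fps_compose_mult_distrib[OF w0]
        power2_eq_square fps_X_compose_eq[OF w0])
  also have "\<dots> = G 0" by (simp add: b_def w_def algebra_simps power2_eq_square)
  also have "\<dots> = CG oo w" using CG by (simp add: w_def)
  finally show ?thesis using fps_compose_inj_right[OF w0 w1] by metis
qed

section \<open>Positivity in C*-algebras\<close>

lemma mult_of_nat_left_commute:
  fixes z w :: "'a::ring_1"
  shows "z * (of_nat m * w) = of_nat m * (z * w)"
  by (metis mult.assoc mult_of_nat_commute)

lemma power_mult_self:
  fixes x :: "'a::monoid_mult"
  shows "x ^ k * x ^ k = (x * x) ^ k"
  using power_mult[of x 2 k] by (simp only: power2_eq_square mult_2 power_add)

lemma binomial_commuting:
  fixes x y :: "'a::ring_1"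
  assumes "x * y = y * x"
  shows "(x + y) ^ n = (\<Sum>k\<le>n. of_nat (n choose k) * (x ^ k * y ^ (n - k)))"
proof (induction n)
  case (Suc n)
  have yx: "y * x ^ k = x ^ k * y" for k
    using assms power_commuting_commutes[of x y k] by simp
  have "(x + y) ^ Suc n = (\<Sum>k\<le>n. of_nat (n choose k) * (x ^ Suc k * y ^ (n - k))) +
      (\<Sum>k\<le>n. of_nat (n choose k) * (x ^ k * y ^ (Suc n - k)))"
  proof -
    have "x * (of_nat m * (x ^ k * z)) = of_nat m * (x ^ Suc k * z)" for k m z
      by (simp add: mult_of_nat_left_commute mult.assoc)
    moreover have "(\<Sum>k\<le>n. y * (of_nat (n choose k) * (x ^ k * y ^ (n - k)))) =
        (\<Sum>k\<le>n. of_nat (n choose k) * (x ^ k * y ^ (Suc n - k)))"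
    proof (rule sum.cong[OF refl])
      fix k assume "k \<in> {..n}"
      then have "y * (x ^ k * y ^ (n - k)) = x ^ k * y ^ (Suc n - k)"
        by (simp add: Suc_diff_le mult.assoc[symmetric] yx)
      then show "y * (of_nat (n choose k) * (x ^ k * y ^ (n - k))) =
          of_nat (n choose k) * (x ^ k * y ^ (Suc n - k))" by (simp add: mult_of_nat_left_commute)
    qed
    ultimately show ?thesis
      by (simp add: Suc distrib_right sum_distrib_left sum.distrib)
  qed
  also have "(\<Sum>k\<le>n. of_nat (n choose k) * (x ^ Suc k * y ^ (n - k))) =
      (\<Sum>k\<le>Suc n. if k = 0 then 0 else of_nat (n choose (k - 1)) * (x ^ k * y ^ (Suc n - k)))"
    by (subst sum.atMost_Suc_shift) simp
  also have "(\<Sum>k\<le>n. of_nat (n choose k) * (x ^ k * y ^ (Suc n - k))) =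
      (\<Sum>k\<le>Suc n. of_nat (n choose k) * (x ^ k * y ^ (Suc n - k)))"
    by (simp add: binomial_eq_0)
  also have "(\<Sum>k\<le>Suc n. if k = 0 then 0 else of_nat (n choose (k - 1)) * (x ^ k * y ^ (Suc n - k))) +
      \<dots> = (\<Sum>k\<le>Suc n. of_nat (Suc n choose k) * (x ^ k * y ^ (Suc n - k)))"
    unfolding sum.distrib[symmetric]
  proof (rule sum.cong[OF refl])
    fix k
    show "(if k = 0 then 0 else of_nat (n choose (k - 1)) * (x ^ k * y ^ (Suc n - k))) +
        of_nat (n choose k) * (x ^ k * y ^ (Suc n - k)) =
        of_nat (Suc n choose k) * (x ^ k * y ^ (Suc n - k))"
      by (cases k) (simp_all add: distrib_right)
  qed
  finally show ?case .
qed simp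

text \<open>The factorial moments of a binomial law, with commuting ring elements as success and
  failure probabilities: \<open>(k choose j) (n choose k) = (n choose j) (n - j choose k -
  j)\<close>, and what remains is the expansion of \<open>(x + y)^(n - j) = 1\<close>.\<close>

lemma binomial_weighted_sum:
  fixes x y :: "'a::ring_1"
  assumes "x * y = y * x" "x + y = 1" "j \<le> n"
  shows "(\<Sum>k\<le>n. of_nat ((k choose j) * (n choose k)) * (x ^ k * y ^ (n - k))) =
    of_nat (n choose j) * x ^ j"
proof -
  have "(\<Sum>k\<le>n. of_nat ((k choose j) * (n choose k)) * (x ^ k * y ^ (n - k))) =
      (\<Sum>k\<in>{j..n}. of_nat ((k choose j) * (n choose k)) * (x ^ k * y ^ (n - k)))"
    by (rule sum.mono_neutral_right) (auto simp: binomial_eq_0)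
  also have "\<dots> = (\<Sum>i\<le>n - j. of_nat (((j + i) choose j) * (n choose (j + i))) * (x ^ (j + i) * y ^ (n - (j + i))))"
    by (rule sum.reindex_bij_witness[of _ "\<lambda>i. j + i" "\<lambda>k. k - j"]) (use assms in auto)
  also have "\<dots> = (\<Sum>i\<le>n - j. of_nat (n choose j) * x ^ j * (of_nat ((n - j) choose i) * (x ^ i * y ^ (n - j - i))))"
  proof (rule sum.cong[OF refl])
    fix i assume "i \<in> {..n - j}"
    then have "(n choose (j + i)) * ((j + i) choose j) = (n choose j) * ((n - j) choose i)"
      using choose_mult[of j "j + i" n] assms by simp
    then have *: "of_nat (((j + i) choose j) * (n choose (j + i))) =
        (of_nat (n choose j) * of_nat ((n - j) choose i) :: 'a)"
      by (metis mult.commute of_nat_mult)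
    show "of_nat (((j + i) choose j) * (n choose (j + i))) * (x ^ (j + i) * y ^ (n - (j + i))) =
      of_nat (n choose j) * x ^ j * (of_nat ((n - j) choose i) * (x ^ i * y ^ (n - j - i)))"
      unfolding * power_add diff_diff_left mult.assoc
      by (simp only: mult_of_nat_left_commute[of "x ^ j"])
  qed
  also have "\<dots> = of_nat (n choose j) * x ^ j * (x + y) ^ (n - j)"
    unfolding sum_distrib_left[symmetric] binomial_commuting[OF assms(1)] ..
  finally show ?thesis using assms by simp
qed

section \<open>Square roots by the binomial series\<close>

lemma abs_gbinomial_half_le_1: "\<bar>(1/2 :: real) gchoose n\<bar> \<le> 1"
proof (induction n)
  case (Suc n)
  have "real (Suc n) * ((1/2) gchoose Suc n) = (1/2 - real n) * ((1/2) gchoose n)"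
    using gbinomial_mult_1[of "1/2 :: real" n] by (simp add: algebra_simps)
  then have "real (Suc n) * \<bar>(1/2) gchoose Suc n\<bar> = \<bar>1/2 - real n\<bar> * \<bar>(1/2) gchoose n\<bar>"
    by (metis abs_mult abs_of_nat)
  also have "\<dots> \<le> real (Suc n) * 1" using Suc by (intro mult_mono) auto
  finally show ?case by simp
qed simp

text \<open>The binomial series of the square root of \<open>1 - h\<close>; it takes the role of
  functional calculus in producing positive elements.\<close>

definition sqrt_series :: "'a::{real_normed_algebra_1, banach} \<Rightarrow> 'a" where
  "sqrt_series h = (\<Sum>n. ((-1) ^ n * ((1/2) gchoose n)) *\<^sub>R h ^ n)"

context
  fixes h :: "'a::{real_normed_algebra_1, banach}"
  assumes h: "norm h < 1"
begin

lemma summable_norm_sqrt_series: "summable (\<lambda>n. norm (((-1) ^ n * ((1/2) gchoose n)) *\<^sub>R h ^ n))"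
proof (rule summable_comparison_test'[OF summable_geometric[of "norm h"], of 0])
  fix n
  have "\<bar>(1/2 :: real) gchoose n\<bar> * norm (h ^ n) \<le> 1 * norm h ^ n"
    by (intro mult_mono abs_gbinomial_half_le_1 norm_power_ineq) auto
  then show "norm (norm (((-1) ^ n * ((1/2) gchoose n)) *\<^sub>R h ^ n)) \<le> norm h ^ n"
    by (simp add: abs_mult power_abs)
qed (use h in auto)

lemmas summable_sqrt_series = summable_norm_cancel[OF summable_norm_sqrt_series]

text \<open>By the Vandermonde identity the Cauchy product has the binomial coefficients of exponent
  \<open>1/2 + 1/2 = 1\<close>, and these vanish from index 2 on.\<close>

lemma sqrt_series_square: "sqrt_series h * sqrt_series h = 1 - h"
proof -
  let ?a = "\<lambda>n. ((-1) ^ n * ((1/2) gchoose n)) *\<^sub>R h ^ n"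
  have "(\<Sum>i\<le>k. ?a i * ?a (k - i)) = ((-1) ^ k * real (1 choose k)) *\<^sub>R h ^ k" for k
  proof -
    have "(\<Sum>i\<le>k. ?a i * ?a (k - i)) =
        (\<Sum>i\<le>k. ((-1) ^ k * (((1/2) gchoose i) * ((1/2) gchoose (k - i)))) *\<^sub>R h ^ k)"
    proof (rule sum.cong[OF refl])
      fix i assume "i \<in> {..k}"
      then have "h ^ i * h ^ (k - i) = h ^ k" "(-1 :: real) ^ i * (-1) ^ (k - i) = (-1) ^ k"
        by (simp_all flip: power_add)
      moreover have "?a i * ?a (k - i) =
          (((-1) ^ i * (-1) ^ (k - i)) * (((1/2) gchoose i) * ((1/2) gchoose (k - i)))) *\<^sub>R (h ^ i * h ^ (k - i))"
        by (simp add: mult_ac)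
      ultimately show "?a i * ?a (k - i) =
          ((-1) ^ k * (((1/2) gchoose i) * ((1/2) gchoose (k - i)))) *\<^sub>R h ^ k" by simp
    qed
    also have "\<dots> = ((-1) ^ k * (\<Sum>i\<le>k. ((1/2) gchoose i) * ((1/2) gchoose (k - i)))) *\<^sub>R h ^ k"
      by (simp add: scaleR_sum_left sum_distrib_left)
    also have "(\<Sum>i\<le>k. ((1/2) gchoose i) * ((1/2) gchoose (k - i))) = (1 :: real) gchoose k"
      using gbinomial_Vandermonde[of "1/2 :: real" "1/2" k] by (simp add: atLeast0AtMost)
    also have "(1 :: real) gchoose k = real (1 choose k)"
      using binomial_gbinomial[of 1 k, where 'a = real] by simp
    finally show ?thesis .
  qed
  then have "(\<lambda>k. ((-1) ^ k * real (1 choose k)) *\<^sub>R h ^ k) sums (sqrt_series h * sqrt_series h)"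
    using Cauchy_product_sums[OF summable_norm_sqrt_series summable_norm_sqrt_series]
    by (simp add: sqrt_series_def)
  moreover have "(\<lambda>k. ((-1) ^ k * real (1 choose k)) *\<^sub>R h ^ k) sums
      (\<Sum>k\<in>{0, 1}. ((-1) ^ k * real (1 choose k)) *\<^sub>R h ^ k)"
  proof (rule sums_finite)
    fix k :: nat assume "k \<notin> {0, 1}"
    then have "1 choose k = 0" by (intro binomial_eq_0) auto
    then show "((-1) ^ k * real (1 choose k)) *\<^sub>R h ^ k = 0" by simp
  qed simp
  ultimately have "sqrt_series h * sqrt_series h = (\<Sum>k\<in>{0, 1}. ((-1) ^ k * real (1 choose k)) *\<^sub>R h ^ k)"
    by (rule sums_unique2)
  then show ?thesis by simp
qed

lemma sqrt_series_commutes: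
  assumes "y * h = h * y"
  shows "y * sqrt_series h = sqrt_series h * y"
proof -
  have "y * h ^ n = h ^ n * y" for n using assms power_commuting_commutes[of h y n] by simp
  then show ?thesis
    unfolding sqrt_series_def suminf_mult[OF summable_sqrt_series, symmetric]
      suminf_mult2[OF summable_sqrt_series] by simp
qed

end

section \<open>Arithmetic of complex scalars and the adjoint\<close>

lemma scaleC_zero_right [simp]: "c *\<^sub>C (0 :: 'a::cstar_algebra) = 0"
  using scaleC_add_right[of c 0 "0 :: 'a"] by simp

lemma scaleC_zero_left [simp]: "0 *\<^sub>C (x :: 'a::cstar_algebra) = 0"
  using scaleR_scaleC[of 0 x] by simp

lemma scaleC_one [simp]: "1 *\<^sub>C (x :: 'a::cstar_algebra) = x"
  using scaleR_scaleC[of 1 x] by simp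

lemma scaleC_minus_one: "(-1) *\<^sub>C (x :: 'a::cstar_algebra) = - x"
  using scaleR_scaleC[of "-1" x] by simp

lemma scaleC_minus_left: "(- c) *\<^sub>C (x :: 'a::cstar_algebra) = - (c *\<^sub>C x)"
  using scaleC_scaleC[of "-1" c x] by (simp add: scaleC_minus_one)

lemma scaleC_minus_right: "c *\<^sub>C (- x :: 'a::cstar_algebra) = - (c *\<^sub>C x)"
  using scaleC_scaleC[of c "-1" x] by (simp add: scaleC_minus_one scaleC_minus_left)

lemma scaleC_diff_right: "c *\<^sub>C (x - y :: 'a::cstar_algebra) = c *\<^sub>C x - c *\<^sub>C y"
  using scaleC_add_right[of c x "- y"] by (simp add: scaleC_minus_right)

lemma adj_scaleR: "adj (r *\<^sub>R x :: 'a::cstar_algebra) = r *\<^sub>R adj x"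
  by (simp add: scaleR_scaleC adj_scaleC)

lemma adj_minus: "adj (- x :: 'a::cstar_algebra) = - adj x"
  using adj_scaleR[of "-1" x] by simp

lemma adj_diff: "adj (x - y :: 'a::cstar_algebra) = adj x - adj y"
  using adj_add[of x "- y"] by (simp add: adj_minus)

lemma adj_one [simp]: "adj (1 :: 'a::cstar_algebra) = 1"
  using adj_mult[of "adj (1 :: 'a)" 1] by (simp add: adj_adj)

lemma adj_power: "adj (x ^ n :: 'a::cstar_algebra) = adj x ^ n"
  by (induction n) (simp_all add: adj_mult power_commutes)

text \<open>The C*-identity and submultiplicativity give \<open>norm y \<le> norm (adj y)\<close>;
  the converse is the same inequality for \<open>adj y\<close>.\<close>

lemma norm_adj [simp]: "norm (adj x :: 'a::cstar_algebra) = norm x"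
proof -
  have le: "norm y \<le> norm (adj y)" for y :: 'a
  proof (cases "norm y = 0")
    case False
    have "norm y * norm y \<le> norm (adj y) * norm y"
      using norm_mult_ineq[of "adj y" y] by (simp add: cstar_identity power2_eq_square)
    then show ?thesis using False by simp
  qed simp
  show ?thesis using le[of x] le[of "adj x"] by (simp add: adj_adj)
qed

lemma bounded_linear_adj: "bounded_linear (adj :: 'a::cstar_algebra \<Rightarrow> 'a)"
  by (rule bounded_linear_intro[of _ 1]) (simp_all add: adj_add adj_scaleR)

lemma self_adjoint_sqrt_series:
  fixes h :: "'a::cstar_algebra"
  assumes "norm h < 1" "self_adjoint h"
  shows "self_adjoint (sqrt_series h)"
  using assms(2) bounded_linear.suminf[OF bounded_linear_adj summable_sqrt_series[OF assms(1)]]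
  by (simp add: self_adjoint_def sqrt_series_def adj_scaleR adj_power)

context cstar_prob_space
begin

lemma state_zero [simp]: "\<tau> 0 = 0"
  using state_scaleC[of 0 0] by simp

lemma state_minus: "\<tau> (- x) = - \<tau> x"
  using state_scaleC[of "-1" x] by (simp add: scaleC_minus_one)

lemma state_diff: "\<tau> (x - y) = \<tau> x - \<tau> y"
  using state_add[of x "- y"] by (simp add: state_minus)

lemma state_scaleR: "\<tau> (r *\<^sub>R x) = r * \<tau> x"
  by (simp add: scaleR_scaleC state_scaleC)

lemma state_sum: "\<tau> (sum f A) = (\<Sum>x\<in>A. \<tau> (f x))"
  by (induction A rule: infinite_finite_induct) (auto simp: state_add)

text \<open>Both \<open>p\<close> and \<open>q\<close> have self-adjoint square roots
  \<open>r\<close> and \<open>t\<close> given by power series in \<open>h\<close>. As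
  \<open>t\<close> commutes with \<open>p\<close>, the product is \<open>adj z * z\<close> for
  \<open>z = r^k * t^l\<close>. These values become the weights in the moment problem for
  \<open>p\<close>.\<close>

lemma state_positive_product:
  assumes h: "norm h < 1" "self_adjoint h"
  defines "p \<equiv> (1/2) *\<^sub>R (1 + h)" and "q \<equiv> (1/2) *\<^sub>R (1 - h)"
  shows "\<tau> (p ^ k * q ^ l) \<in> \<real>\<^sub>\<ge>\<^sub>0"
proof -
  define r where "r = sqrt (1/2) *\<^sub>R sqrt_series (- h)"
  define t where "t = sqrt (1/2) *\<^sub>R sqrt_series h"
  have half: "sqrt (1/2) * sqrt (1/2) = (1/2 :: real)" by simp
  have h': "norm (- h) < 1" "self_adjoint (- h)" using h by (auto simp: self_adjoint_def adj_minus)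
  have r: "r * r = p" "adj r = r"
    using sqrt_series_square[OF h'(1)] self_adjoint_sqrt_series[OF h'] half
    by (simp_all add: r_def p_def self_adjoint_def adj_scaleR del: real_sqrt_mult_self)
  have t: "t * t = q" "adj t = t"
    using sqrt_series_square[OF h(1)] self_adjoint_sqrt_series[OF h] half
    by (simp_all add: t_def q_def self_adjoint_def adj_scaleR del: real_sqrt_mult_self)
  have "p * h = h * p" by (simp add: p_def algebra_simps)
  then have "p * t = t * p" using sqrt_series_commutes[OF h(1)] by (simp add: t_def)
  then have pt: "p ^ k * t ^ l = t ^ l * p ^ k"
    using power_commuting_commutes[of p t k] power_commuting_commutes[of t "p ^ k" l] by simp
  have "adj (r ^ k * t ^ l) * (r ^ k * t ^ l) = t ^ l * (r ^ k * r ^ k) * t ^ l"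
    by (simp add: adj_mult adj_power r t mult.assoc)
  also have "r ^ k * r ^ k = p ^ k"
    by (simp add: power_mult_self r)
  also have "t ^ l * p ^ k * t ^ l = p ^ k * (t ^ l * t ^ l)" by (simp flip: pt add: mult.assoc)
  also have "t ^ l * t ^ l = q ^ l"
    by (simp add: power_mult_self t)
  finally show ?thesis using state_positive[of "r ^ k * t ^ l"] by simp
qed

end

section \<open>Moment problems with compact support\<close>

lemma compact_real_distributionD:
  assumes "compact_real_distribution M"
  shows "real_distribution M" "\<exists>R\<ge>0. AE t in M. \<bar>t\<bar> \<le> R"
proof -
  from assms show M: "real_distribution M" by (simp add: compact_real_distribution_def)
  interpret real_distribution M by (rule M)
  from assms obtain K where K: "compact K" "measure M K = 1"
    by (auto simp: compact_real_distribution_def)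
  then obtain R where R: "\<And>t. t \<in> K \<Longrightarrow> norm t \<le> R"
    using compact_imp_bounded bounded_iff by metis
  have "K \<in> events" using K(1) by (simp add: borel_compact)
  then have "AE t in M. t \<in> K" using K(2) by (intro AE_prob_1)
  then have "AE t in M. \<bar>t\<bar> \<le> \<bar>R\<bar>" by eventually_elim (use R in fastforce)
  then show "\<exists>R\<ge>0. AE t in M. \<bar>t\<bar> \<le> R" by (intro exI[of _ "\<bar>R\<bar>"]) simp
qed

lemma (in real_distribution) integrable_AE_bounded:
  fixes f :: "real \<Rightarrow> 'b::{banach, second_countable_topology}"
  assumes "f \<in> borel_measurable borel" "AE t in M. norm (f t) \<le> B"
  shows "integrable M f"
  using assms by (intro integrable_const_bound[of _ B]) auto

text \<open>Bounded support dominates the exponential series, so sum and integral may be exchanged.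
  The characteristic function, and with it the measure, thus depends only on the moments.\<close>

lemma (in real_distribution) char_eq_moment_series:
  assumes R: "R \<ge> 0" "AE t in M. \<bar>t\<bar> \<le> R"
  shows "char M u = (\<Sum>n. (\<i> * u) ^ n / fact n * (\<integral>t. t ^ n \<partial>M))"
proof -
  let ?f = "\<lambda>n t. (\<i> * of_real (u * t)) ^ n / fact n :: complex"
  let ?B = "\<lambda>n. (\<bar>u\<bar> * R) ^ n / fact n"
  have bd: "AE t in M. norm (?f n t) \<le> ?B n" for n
    using R(2)
  proof eventually_elim
    case (elim t)
    have "(\<bar>u\<bar> * \<bar>t\<bar>) ^ n \<le> (\<bar>u\<bar> * R) ^ n" using elim by (intro power_mono mult_left_mono) auto
    then show ?case by (simp add: norm_divide norm_power norm_mult divide_right_mono abs_mult)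
  qed
  have int: "integrable M (?f n)" for n
    by (rule integrable_AE_bounded[OF _ bd]) measurable
  have sB: "summable ?B" using summable_exp[of "\<bar>u\<bar> * R"] by (simp add: field_simps)
  have "char M u = (\<integral>t. (\<Sum>n. ?f n t) \<partial>M)"
    unfolding char_def
    by (rule Bochner_Integration.integral_cong) (auto simp: exp_def scaleR_conv_of_real field_simps)
  also have "\<dots> = (\<Sum>n. \<integral>t. ?f n t \<partial>M)"
  proof (rule integral_suminf[OF int])
    have "AE t in M. \<forall>n. norm (?f n t) \<le> ?B n" using bd by (simp add: AE_all_countable)
    then show "AE t in M. summable (\<lambda>n. norm (?f n t))"
      by eventually_elim (auto intro: summable_comparison_test'[OF sB])
    show "summable (\<lambda>n. \<integral>t. norm (?f n t) \<partial>M)"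
    proof (rule summable_comparison_test'[OF sB, of 0])
      fix n
      have "(\<integral>t. norm (?f n t) \<partial>M) \<le> (\<integral>t. ?B n \<partial>M)"
        by (rule integral_mono_AE[OF integrable_norm[OF int] _ bd]) simp
      also have "\<dots> = ?B n" using prob_space by simp
      finally show "norm (\<integral>t. norm (?f n t) \<partial>M) \<le> ?B n" by simp
    qed
  qed
  also have "(\<lambda>n. \<integral>t. ?f n t \<partial>M) = (\<lambda>n. (\<i> * u) ^ n / fact n * (\<integral>t. t ^ n \<partial>M))"
  proof
    fix n
    have "(\<integral>t. ?f n t \<partial>M) = (\<integral>t. (\<i> * u) ^ n / fact n * complex_of_real (t ^ n) \<partial>M)"
      by (rule Bochner_Integration.integral_cong) (auto simp: power_mult_distrib)
    then show "(\<integral>t. ?f n t \<partial>M) = (\<i> * u) ^ n / fact n * (\<integral>t. t ^ n \<partial>M)"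
      by (simp del: of_real_power)
  qed
  finally show ?thesis .
qed

lemma compact_real_distribution_moment_unique:
  assumes "compact_real_distribution M" "compact_real_distribution N"
    and "\<And>n. (\<integral>t. t ^ n \<partial>M) = (\<integral>t. t ^ n \<partial>N)"
  shows "M = N"
proof (rule Levy_uniqueness)
  show M: "real_distribution M" and N: "real_distribution N"
    using compact_real_distributionD assms by auto
  obtain R where R: "R \<ge> 0" "AE t in M. \<bar>t\<bar> \<le> R" using compact_real_distributionD assms by blast
  obtain S where S: "S \<ge> 0" "AE t in N. \<bar>t\<bar> \<le> S" using compact_real_distributionD assms by blast
  show "char M = char N"
    using real_distribution.char_eq_moment_series[OF M R] real_distribution.char_eq_moment_series[OF N S]
      assms(3) by auto
qed

text \<open>Links the complex cumulants of algebra elements with the real cumulants of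
  measures.\<close>

lemma free_cumulant_of_real:
  "free_cumulant (\<lambda>k. complex_of_real (m k)) n = complex_of_real (free_cumulant m n)"
proof (induction n rule: less_induct)
  case (less n)
  have "(\<Prod>V\<in>P. free_cumulant (\<lambda>k. complex_of_real (m k)) (card V)) =
      complex_of_real (\<Prod>V\<in>P. free_cumulant m (card V))" if "P \<in> NC n - {{{..<n}}}" for P
    using less card_NC_block_less[OF that] by simp
  then show ?case
    unfolding free_cumulant.simps[of _ n] by simp
qed

lemma compact_real_distribution_cumulant_unique:
  assumes M: "compact_real_distribution M" and N: "compact_real_distribution N"
    and c: "\<And>n. n \<ge> 1 \<Longrightarrow> measure_cumulant M n = measure_cumulant N n"
  shows "M = N"
proof (rule compact_real_distribution_moment_unique[OF M N])
  interpret M: real_distribution M using compact_real_distributionD(1)[OF M] .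
  interpret N: real_distribution N using compact_real_distributionD(1)[OF N] .
  fix n
  show "(\<integral>t. t ^ n \<partial>M) = (\<integral>t. t ^ n \<partial>N)"
  proof (cases "n = 0")
    case True
    then show ?thesis using M.prob_space N.prob_space by simp
  next
    case False
    have "measure_cumulant M (card V) = measure_cumulant N (card V)" if "P \<in> NC n" "V \<in> P" for P V
    proof -
      have "V \<subseteq> {..<n}" "V \<noteq> {}" using that by (auto simp: NC_def partition_on_def)
      then have "card V \<ge> 1"
        using finite_subset[of V "{..<n}"] card_gt_0_iff[of V] by auto
      then show ?thesis by (rule c)
    qed
    then show ?thesis
      using moment_free_cumulant[of n "\<lambda>k. \<integral>t. t ^ k \<partial>M"] moment_free_cumulant[of n "\<lambda>k. \<integral>t. t ^ k \<partial>N"] False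
      unfolding measure_cumulant_def[symmetric] by simp
  qed
qed

text \<open>The ratio of binomial coefficients is the product of \<open>(k - i) / (n - i)\<close>
  over \<open>i < j\<close>. Each factor is within \<open>j / (n - j)\<close> of
  \<open>k / n\<close>, and since all factors have modulus at most 1 the errors merely add up. This
  compares binomial moments with power moments.\<close>

lemma falling_ratio_approx:
  fixes j k n :: nat
  assumes "k \<le> n" "2 * j < n"
  shows "\<bar>real (k choose j) / real (n choose j) - (real k / real n) ^ j\<bar> \<le> real j * real j / (real n - real j)"
proof -
  let ?z = "\<lambda>i. (real k - real i) / (real n - real i)"
  have fact: "real (m choose j) = (\<Prod>i<j. real m - real i) / fact j" for m
    using binomial_gbinomial[of m j, where 'a = real] by (simp add: gbinomial_prod_rev atLeast0LessThan)
  have "real (k choose j) / real (n choose j) = (\<Prod>i<j. ?z i)"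
    by (simp add: fact prod_dividef)
  moreover have "(real k / real n) ^ j = (\<Prod>i<j. real k / real n)" by simp
  ultimately have "\<bar>real (k choose j) / real (n choose j) - (real k / real n) ^ j\<bar> =
      norm ((\<Prod>i<j. ?z i) - (\<Prod>i<j. real k / real n))" by simp
  also have "\<dots> \<le> (\<Sum>i<j. norm (?z i - real k / real n))"
  proof (rule norm_prod_diff)
    fix i assume "i \<in> {..<j}"
    then have i: "real i < real j" by simp
    \<comment> \<open>For \<open>k < i\<close> the numerator is negative; its modulus is then
      controlled through \<open>2 * j < n\<close>.\<close>
    have "\<bar>real k - real i\<bar> \<le> real n - real i" using assms i by (simp add: abs_le_iff)
    moreover have "real n - real i > 0" using assms i by linarith
    ultimately show "norm (?z i) \<le> 1" by (simp add: abs_divide divide_le_eq)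
    show "norm (real k / real n) \<le> 1" using assms by (simp add: divide_le_eq)
  qed
  also have "\<dots> \<le> (\<Sum>i<j. real j / (real n - real j))"
  proof (rule sum_mono)
    fix i assume "i \<in> {..<j}"
    then have i: "real i < real j" by simp
    have pos: "real n - real i > 0" "real n - real j > 0" "real n > 0" using assms i by linarith+
    have "real k / real n - ?z i = real i * (real n - real k) / (real n * (real n - real i))"
      using pos by (simp add: field_simps)
    also have "\<dots> = (real i / (real n - real i)) * ((real n - real k) / real n)" by simp
    finally have e: "real k / real n - ?z i = (real i / (real n - real i)) * ((real n - real k) / real n)" .
    have "(real i / (real n - real i)) * ((real n - real k) / real n) \<le> (real j / (real n - real j)) * 1"
    proof (rule mult_mono)
      show "real i / (real n - real i) \<le> real j / (real n - real j)"
        using pos i by (intro frac_le) auto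
      show "(real n - real k) / real n \<le> 1" using pos by (simp add: divide_le_eq)
      show "0 \<le> (real n - real k) / real n" using pos assms by simp
    qed (use pos in simp)
    moreover have "0 \<le> (real i / (real n - real i)) * ((real n - real k) / real n)"
      using pos assms by simp
    ultimately show "norm (?z i - real k / real n) \<le> real j / (real n - real j)"
      unfolding real_norm_def abs_minus_commute[of "?z i"] e by (simp only: abs_of_nonneg mult_1_right)
  qed
  finally show ?thesis by simp
qed

lemma weighted_point_masses:
  fixes w :: "nat \<Rightarrow> real" and x :: "nat \<Rightarrow> real"
  assumes "\<And>k. w k \<ge> 0" "(\<Sum>k\<le>n. w k) = 1"
  obtains M where "real_distribution M" "\<And>f::real \<Rightarrow> real. f \<in> borel_measurable borel \<Longrightarrow> (\<integral>t. f t \<partial>M) = (\<Sum>k\<le>n. w k * f (x k))"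
    "\<And>A. A \<in> sets borel \<Longrightarrow> x ` {..n} \<subseteq> A \<Longrightarrow> measure M A = 1"
proof -
  define g where "g k = (if k \<le> n then w k else 0)" for k
  have nn: "g k \<ge> 0" for k using assms by (simp add: g_def)
  have "(\<integral>\<^sup>+k. ennreal (g k) \<partial>count_space UNIV) = (\<integral>\<^sup>+k. ennreal (g k) \<partial>count_space {..n})"
    by (rule nn_integral_count_space_eq) (auto simp: g_def)
  also have "\<dots> = (\<Sum>k\<le>n. ennreal (g k))" by (simp add: nn_integral_count_space_finite)
  also have "\<dots> = ennreal (\<Sum>k\<le>n. g k)" using nn by (simp add: sum_ennreal)
  also have "(\<Sum>k\<le>n. g k) = 1" using assms(2) by (simp add: g_def)
  finally have one: "(\<integral>\<^sup>+k. ennreal (g k) \<partial>count_space UNIV) = 1" by simp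
  define P where "P = embed_pmf g"
  have P: "pmf P k = g k" for k unfolding P_def by (rule pmf_embed_pmf[OF nn one])
  have sub: "set_pmf P \<subseteq> {..n}" by (auto simp: set_pmf_eq P g_def)
  define M where "M = distr (measure_pmf P) borel x"
  have meas: "x \<in> measure_pmf P \<rightarrow>\<^sub>M borel" by simp
  have "real_distribution M"
    unfolding M_def real_distribution_def real_distribution_axioms_def
    using measure_pmf.prob_space_distr[OF meas] by simp
  moreover have "(\<integral>t. f t \<partial>M) = (\<Sum>k\<le>n. w k * f (x k))" if "f \<in> borel_measurable borel"
    for f :: "real \<Rightarrow> real"
  proof -
    have "(\<integral>t. f t \<partial>M) = (\<integral>k. f (x k) \<partial>measure_pmf P)"
      unfolding M_def by (rule integral_distr[OF meas that])
    also have "\<dots> = (\<Sum>k\<le>n. f (x k) * pmf P k)"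
      by (rule integral_measure_pmf_real) (use sub in auto)
    finally show ?thesis by (simp add: P g_def mult.commute)
  qed
  moreover have "measure M A = 1" if "A \<in> sets borel" "x ` {..n} \<subseteq> A" for A
  proof -
    have "measure M A = measure (measure_pmf P) (x -` A)"
      unfolding M_def using measure_distr[OF meas that(1)] by simp
    also have "\<dots> = 1" using sub that(2) by (subst measure_pmf.prob_eq_1) (auto simp: AE_measure_pmf_iff)
    finally show ?thesis .
  qed
  ultimately show ?thesis using that by blast
qed

text \<open>
  The measures with mass \<open>w n k\<close> at \<open>k / n\<close> are those of Bernstein's approximation; their
  binomial moments are exact, so the power moments are exact in the limit.
\<close>

lemma hausdorff_moment_problem:
  fixes w :: "nat \<Rightarrow> nat \<Rightarrow> real" and m :: "nat \<Rightarrow> real"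
  assumes nonneg: "\<And>n k. w n k \<ge> 0" and total: "\<And>n. (\<Sum>k\<le>n. w n k) = 1"
    and moments: "\<And>j n. j \<le> n \<Longrightarrow> (\<Sum>k\<le>n. real (k choose j) * w n k) = real (n choose j) * m j"
  shows "\<exists>M. real_distribution M \<and> (AE t in M. t \<in> {0..1}) \<and> (\<forall>j. (\<integral>t. t ^ j \<partial>M) = m j)"
proof -
  \<comment> \<open>The minimum keeps every point in the unit interval even for
    \<open>k > n\<close>; for \<open>n = 0\<close> division by zero gives the point 0.\<close>
  define x where "x n k = real (min k n) / real n" for n k
  have x01: "x n k \<in> {0..1}" for n k by (simp add: x_def divide_le_eq)
  have "\<exists>M. real_distribution M \<and> (\<forall>f::real \<Rightarrow> real. f \<in> borel_measurable borel \<longrightarrow>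
      (\<integral>t. f t \<partial>M) = (\<Sum>k\<le>n. w n k * f (x n k))) \<and>
      (\<forall>A\<in>sets borel. x n ` {..n} \<subseteq> A \<longrightarrow> measure M A = 1)" for n
    using weighted_point_masses[of "w n" n "x n"] nonneg total by metis
  then obtain \<mu> where \<mu>: "\<And>n. real_distribution (\<mu> n)"
    and int: "\<And>n f. (f :: real \<Rightarrow> real) \<in> borel_measurable borel \<Longrightarrow>
      (\<integral>t. f t \<partial>\<mu> n) = (\<Sum>k\<le>n. w n k * f (x n k))"
    and meas: "\<And>n A. A \<in> sets borel \<Longrightarrow> x n ` {..n} \<subseteq> A \<Longrightarrow> measure (\<mu> n) A = 1"
    by metis
  have "tight \<mu>"
    unfolding tight_def
  proof (intro conjI allI impI \<mu>)
    fix \<epsilon> :: real assume "\<epsilon> > 0"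
    have "measure (\<mu> n) {-1<..2} = 1" for n
    proof (rule meas)
      have "x n k \<in> {-1<..2}" for k using x01[of n k] by auto
      then show "x n ` {..n} \<subseteq> {-1<..2}" by blast
    qed simp
    then show "\<exists>a b. a < b \<and> (\<forall>n. 1 - \<epsilon> < measure (\<mu> n) {a<..b})"
      using \<open>\<epsilon> > 0\<close> by (intro exI[of _ "-1"] exI[of _ 2]) auto
  qed
  from tight_imp_convergent_subsubsequence[OF this strict_mono_id]
  obtain r M where r: "strict_mono (r :: nat \<Rightarrow> nat)" and M: "real_distribution M"
    and conv: "weak_conv_m (\<mu> \<circ> r) M"
    by auto
  interpret real_distribution M by (rule M)
  have lim: "(\<lambda>n. \<integral>t. f t \<partial>\<mu> (r n)) \<longlonglongrightarrow> (\<integral>t. f t \<partial>M)"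
    if "\<And>t. isCont f t" "\<And>t. norm (f t) \<le> B" for f :: "real \<Rightarrow> real" and B
    using weak_conv_imp_integral_bdd_continuous_conv[OF _ M conv, of f B] \<mu> that by simp
  \<comment> \<open>Weak convergence only tests bounded continuous functions, so powers are taken of
    the projection \<open>cl\<close> onto the unit interval, which fixes all point masses.\<close>
  define cl where "cl t = max 0 (min 1 t)" for t :: real
  have cl_meas [measurable]: "cl \<in> borel_measurable borel" unfolding cl_def by simp
  have cl_cont: "isCont cl t" for t unfolding cl_def by (intro continuous_intros)
  have cl01: "0 \<le> cl t" "cl t \<le> 1" for t by (auto simp: cl_def)
  have cl_x: "cl (x n k) = x n k" for n k using x01[of n k] by (simp add: cl_def)
  have supp: "AE t in M. t = cl t"
  proof -
    \<comment> \<open>A bounded continuous function that vanishes exactly on the unit interval; its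
      integral is 0 along the sequence, hence also in the limit.\<close>
    let ?f = "\<lambda>t. min 1 \<bar>t - cl t\<bar>"
    have "(\<lambda>n. \<integral>t. ?f t \<partial>\<mu> (r n)) \<longlonglongrightarrow> (\<integral>t. ?f t \<partial>M)"
      by (rule lim[of _ 1]) (auto intro!: continuous_intros cl_cont)
    moreover have "(\<integral>t. ?f t \<partial>\<mu> (r n)) = 0" for n
      by (subst int) (auto simp: cl_x)
    ultimately have "(\<integral>t. ?f t \<partial>M) = 0" by (simp add: LIMSEQ_const_iff)
    moreover have "integrable M ?f" by (rule integrable_AE_bounded[of _ 1]) auto
    ultimately have "AE t in M. ?f t = 0" by (subst (asm) integral_nonneg_eq_0_iff_AE) auto
    then show ?thesis by eventually_elim (auto simp: min_def split: if_splits)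
  qed
  have "(\<integral>t. t ^ j \<partial>M) = m j" for j
  proof -
    have "(\<lambda>n. \<integral>t. cl t ^ j \<partial>\<mu> (r n)) \<longlonglongrightarrow> (\<integral>t. cl t ^ j \<partial>M)"
      by (rule lim[of _ 1]) (auto intro!: continuous_intros cl_cont power_le_one simp: cl01 power_abs[symmetric])
    moreover have "(\<lambda>n. \<integral>t. cl t ^ j \<partial>\<mu> (r n)) \<longlonglongrightarrow> m j"
    proof -
      have bd: "\<bar>(\<integral>t. cl t ^ j \<partial>\<mu> n) - m j\<bar> \<le> real j * real j / (real n - real j)" if n: "2 * j < n" for n
      proof -
        have pos: "real (n choose j) > 0" using n by (simp add: zero_less_binomial)
        have "(\<integral>t. cl t ^ j \<partial>\<mu> n) = (\<Sum>k\<le>n. w n k * (real k / real n) ^ j)"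
        proof (subst int)
          have "cl (x n k) = real k / real n" if "k \<le> n" for k
            unfolding cl_x using that by (simp add: x_def min_def)
          then show "(\<Sum>k\<le>n. w n k * cl (x n k) ^ j) = (\<Sum>k\<le>n. w n k * (real k / real n) ^ j)"
            by simp
        qed simp
        moreover have "m j = (\<Sum>k\<le>n. w n k * (real (k choose j) / real (n choose j)))"
          using moments[of j n] n pos by (simp add: field_simps flip: sum_divide_distrib)
        ultimately have "\<bar>(\<integral>t. cl t ^ j \<partial>\<mu> n) - m j\<bar> =
            \<bar>\<Sum>k\<le>n. w n k * ((real k / real n) ^ j - real (k choose j) / real (n choose j))\<bar>"
          by (simp only: right_diff_distrib sum_subtractf)
        also have "\<dots> \<le> (\<Sum>k\<le>n. \<bar>w n k * ((real k / real n) ^ j - real (k choose j) / real (n choose j))\<bar>)"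
          by (rule sum_abs)
        also have "\<dots> \<le> (\<Sum>k\<le>n. w n k * (real j * real j / (real n - real j)))"
        proof (rule sum_mono)
          fix k assume "k \<in> {..n}"
          then show "\<bar>w n k * ((real k / real n) ^ j - real (k choose j) / real (n choose j))\<bar> \<le>
              w n k * (real j * real j / (real n - real j))"
            unfolding abs_mult abs_of_nonneg[OF nonneg]
            using falling_ratio_approx[of k n j] n nonneg[of n k]
            by (intro mult_left_mono) (auto simp: abs_minus_commute)
        qed
        also have "\<dots> = real j * real j / (real n - real j)"
          unfolding sum_distrib_right[symmetric] total by simp
        finally show ?thesis .
      qed
      have ev: "\<forall>\<^sub>F n in sequentially. 2 * j < r n"
        using eventually_gt_at_top[of "2 * j"]
        by eventually_elim (use seq_suble[OF r] less_le_trans in blast)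
      have "(\<lambda>n. real j * real j / (real n - real j)) \<longlonglongrightarrow> 0" by real_asymp
      then have lim0: "(\<lambda>n. real j * real j / (real (r n) - real j)) \<longlonglongrightarrow> 0"
        using LIMSEQ_subseq_LIMSEQ[OF _ r] by (fastforce simp: o_def)
      have "(\<lambda>n. (\<integral>t. cl t ^ j \<partial>\<mu> (r n)) - m j) \<longlonglongrightarrow> 0"
        by (rule Lim_null_comparison[OF eventually_mono[OF ev] lim0]) (use bd in simp)
      then show ?thesis by (simp add: LIM_zero_iff)
    qed
    ultimately have "(\<integral>t. cl t ^ j \<partial>M) = m j" by (rule LIMSEQ_unique)
    moreover have "(\<integral>t. t ^ j \<partial>M) = (\<integral>t. cl t ^ j \<partial>M)"
    proof (rule integral_cong_AE)
      show "AE t in M. t ^ j = cl t ^ j" using supp by eventually_elim simp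
    qed simp_all
    ultimately show ?thesis by simp
  qed
  moreover have "AE t in M. t \<in> {0..1}" using supp
  proof eventually_elim
    case (elim t)
    then show ?case using cl01[of t] by simp
  qed
  ultimately show ?thesis using M by blast
qed

section \<open>Distributions of self-adjoint elements\<close>

context cstar_prob_space
begin

text \<open>With \<open>q = 1 - p\<close>, the weight at \<open>k\<close> is
  \<open>(n choose k) \<tau>(p^k q^(n-k))\<close>. It is nonnegative by
  \<open>state_positive_product\<close>, and \<open>binomial_weighted_sum\<close> supplies the
  binomial moments; the case \<open>j = 0\<close> is the total mass.\<close>

lemma hausdorff_moments_of_contraction:
  assumes h: "norm h < 1" "self_adjoint h"
  defines "p \<equiv> (1/2) *\<^sub>R (1 + h)"
  shows "\<exists>M. real_distribution M \<and> (AE t in M. t \<in> {0..1}) \<and>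
    (\<forall>j. complex_of_real (\<integral>t. t ^ j \<partial>M) = \<tau> (p ^ j))"
proof -
  define q where "q = (1/2) *\<^sub>R (1 - h)"
  define w where "w n k = real (n choose k) * Re (\<tau> (p ^ k * q ^ (n - k)))" for n k
  have pos: "\<tau> (p ^ k * q ^ l) \<in> \<real>\<^sub>\<ge>\<^sub>0" for k l
    unfolding p_def q_def by (rule state_positive_product[OF h])
  have pq: "p * q = q * p" "p + q = 1"
    by (simp_all add: p_def q_def algebra_simps flip: scaleR_add_left)
  have moments: "(\<Sum>k\<le>n. real (k choose j) * w n k) = real (n choose j) * Re (\<tau> (p ^ j))" if "j \<le> n" for j n
  proof -
    have nat: "\<tau> (of_nat m * y) = of_nat m * \<tau> y" for m y
      using state_scaleR[of "real m" y] by (simp add: scaleR_conv_of_real)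
    have "(\<Sum>k\<le>n. \<tau> (of_nat ((k choose j) * (n choose k)) * (p ^ k * q ^ (n - k)))) =
        \<tau> (of_nat (n choose j) * p ^ j)"
      using binomial_weighted_sum[OF pq that] by (simp add: state_sum[symmetric])
    then have "(\<Sum>k\<le>n. of_nat ((k choose j) * (n choose k)) * \<tau> (p ^ k * q ^ (n - k))) =
        of_nat (n choose j) * \<tau> (p ^ j)"
      by (simp only: nat)
    from arg_cong[OF this, of Re] show ?thesis
      by (simp add: w_def mult.assoc)
  qed
  have nonneg: "w n k \<ge> 0" for n k
    using pos[of k "n - k"] by (auto simp: w_def nonneg_Reals_def)
  have total: "(\<Sum>k\<le>n. w n k) = 1" for n
    using moments[of 0 n] by (simp add: state_one)
  have "\<tau> (p ^ j) = complex_of_real (Re (\<tau> (p ^ j)))" for j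
    using pos[of j 0] by (auto simp: nonneg_Reals_def elim!: Reals_cases)
  then show ?thesis using hausdorff_moment_problem[OF nonneg total moments] by metis
qed

lemma distribution_exists:
  assumes "self_adjoint a"
  shows "\<exists>M. compact_real_distribution M \<and> (\<forall>n. complex_of_real (\<integral>t. t ^ n \<partial>M) = \<tau> (a ^ n))"
proof -
  \<comment> \<open>The additional 1 makes the bound strict and \<open>C\<close> positive, also for
    \<open>a = 0\<close>. Then \<open>a = 2 C p - C\<close>, and the law of \<open>a\<close> is the
    image of that of \<open>p\<close> under the affine map \<open>f\<close>.\<close>
  define C where "C = norm a + 1"
  have C: "C > 0" "norm a < C" by (auto simp: C_def add_nonneg_pos)
  define h where "h = (1 / C) *\<^sub>R a"
  define p where "p = (1/2) *\<^sub>R (1 + h)"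
  have "norm h < 1" "self_adjoint h"
    using C assms by (auto simp: h_def self_adjoint_def adj_scaleR divide_less_eq)
  from hausdorff_moments_of_contraction[OF this] obtain M
    where M: "real_distribution M" and supp: "AE t in M. t \<in> {0..1}"
      and mom: "\<And>j. complex_of_real (\<integral>t. t ^ j \<partial>M) = \<tau> (p ^ j)"
    unfolding p_def by blast
  interpret M: real_distribution M by (rule M)
  define f where "f t = 2 * C * t - C" for t :: real
  have f_meas [measurable]: "f \<in> borel_measurable borel" unfolding f_def by simp
  have f_bd: "AE t in M. \<bar>f t\<bar> \<le> C"
    using supp
  proof eventually_elim
    case (elim t)
    then have "0 \<le> C * t" "C * t \<le> C * 1" using C by (auto intro!: mult_left_mono simp del: mult_1_right)
    then show ?case by (simp add: f_def abs_le_iff)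
  qed
  have int: "integrable M (\<lambda>t. t ^ j * f t ^ n)" for j n
  proof (rule M.integrable_AE_bounded[of _ "1 * C ^ n"])
    show "AE t in M. norm (t ^ j * f t ^ n) \<le> 1 * C ^ n"
      using supp f_bd
    proof eventually_elim
      case (elim t)
      then show ?case unfolding norm_mult norm_power
        by (intro mult_mono power_mono power_le_one) auto
    qed
  qed simp
  have a: "a = (2 * C) *\<^sub>R p - C *\<^sub>R 1"
    using C by (simp add: p_def h_def algebra_simps)
  \<comment> \<open>Mixed moments make the induction work: each factor
    \<open>f t = 2 C t - C\<close> is traded for a power of \<open>t\<close>, as each factor
    \<open>a\<close> is for a power of \<open>p\<close>.\<close>
  have step: "complex_of_real (\<integral>t. t ^ j * f t ^ n \<partial>M) = \<tau> (p ^ j * a ^ n)" for j n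
  proof (induction n arbitrary: j)
    case 0
    then show ?case using mom by simp
  next
    case (Suc n)
    have "(\<integral>t. t ^ j * f t ^ Suc n \<partial>M) = (\<integral>t. (2 * C) * (t ^ Suc j * f t ^ n) - C * (t ^ j * f t ^ n) \<partial>M)"
      by (rule Bochner_Integration.integral_cong) (simp_all add: f_def algebra_simps)
    also have "\<dots> = (2 * C) * (\<integral>t. t ^ Suc j * f t ^ n \<partial>M) - C * (\<integral>t. t ^ j * f t ^ n \<partial>M)"
      using int[of "Suc j" n] int[of j n] by (subst Bochner_Integration.integral_diff) auto
    finally have "complex_of_real (\<integral>t. t ^ j * f t ^ Suc n \<partial>M) =
        (2 * C) * \<tau> (p ^ Suc j * a ^ n) - C * \<tau> (p ^ j * a ^ n)"
      by (simp only: of_real_diff of_real_mult Suc)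
    also have "\<dots> = \<tau> (p ^ j * ((2 * C) *\<^sub>R p - C *\<^sub>R 1) * a ^ n)"
      by (simp add: right_diff_distrib left_diff_distrib state_diff state_scaleR power_commutes)
    also have "p ^ j * ((2 * C) *\<^sub>R p - C *\<^sub>R 1) * a ^ n = p ^ j * a ^ Suc n"
      unfolding a[symmetric] by (simp add: mult.assoc)
    finally show ?case .
  qed
  define N where "N = distr M borel f"
  have N: "real_distribution N"
    unfolding N_def real_distribution_def real_distribution_axioms_def
    using M.prob_space_distr[of f borel] by simp
  interpret N: real_distribution N by (rule N)
  have "AE t in N. t \<in> {-C..C}"
    unfolding N_def
  proof (subst AE_distr_iff)
    show "AE t in M. f t \<in> {-C..C}" using f_bd by eventually_elim auto
  qed simp_all
  then have "measure N {-C..C} = 1" by (subst N.prob_eq_1) auto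
  then have "compact_real_distribution N"
    unfolding compact_real_distribution_def using N compact_Icc by blast
  moreover have "complex_of_real (\<integral>t. t ^ n \<partial>N) = \<tau> (a ^ n)" for n
    using step[of 0 n] by (simp add: N_def integral_distr)
  ultimately show ?thesis by blast
qed

lemma distribution_spec:
  assumes "self_adjoint a"
  shows "compact_real_distribution (distribution \<tau> a)"
    and "complex_of_real (\<integral>t. t ^ n \<partial>distribution \<tau> a) = \<tau> (a ^ n)"
proof -
  have "\<exists>!M. compact_real_distribution M \<and> (\<forall>n. complex_of_real (\<integral>t. t ^ n \<partial>M) = \<tau> (a ^ n))"
    using distribution_exists[OF assms]
    by (elim ex_ex1I) (metis compact_real_distribution_moment_unique of_real_eq_iff)
  from theI'[OF this] show "compact_real_distribution (distribution \<tau> a)"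
    and "complex_of_real (\<integral>t. t ^ n \<partial>distribution \<tau> a) = \<tau> (a ^ n)"
    unfolding distribution_def by blast+
qed

lemma measure_cumulant_distribution:
  assumes "self_adjoint a"
  shows "complex_of_real (measure_cumulant (distribution \<tau> a) n) = elem_cumulant \<tau> a n"
  unfolding measure_cumulant_def elem_cumulant_def
  by (simp add: free_cumulant_of_real[symmetric] distribution_spec(2)[OF assms])

text \<open>The distribution of \<open>c\<close> itself witnesses the definite description behind
  \<open>\<boxplus>\<close>; it is the only solution because cumulants determine a compactly
  supported measure.\<close>

lemma distribution_eq_free_convolution:
  assumes "self_adjoint a" "self_adjoint b" "self_adjoint c"
    and "\<And>n. n \<ge> 1 \<Longrightarrow> elem_cumulant \<tau> c n = elem_cumulant \<tau> a n + elem_cumulant \<tau> b n"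
  shows "distribution \<tau> c = distribution \<tau> a \<boxplus> distribution \<tau> b"
  unfolding free_convolution_def
proof (rule the_equality[symmetric])
  have *: "measure_cumulant (distribution \<tau> c) n =
      measure_cumulant (distribution \<tau> a) n + measure_cumulant (distribution \<tau> b) n" if "n \<ge> 1" for n
  proof -
    have "complex_of_real (measure_cumulant (distribution \<tau> c) n) =
        complex_of_real (measure_cumulant (distribution \<tau> a) n + measure_cumulant (distribution \<tau> b) n)"
      using assms(4)[OF that] by (simp add: measure_cumulant_distribution assms(1-3))
    then show ?thesis by (simp only: of_real_eq_iff)
  qed
  then show "compact_real_distribution (distribution \<tau> c) \<and> (\<forall>n\<ge>1.
      measure_cumulant (distribution \<tau> c) n =
      measure_cumulant (distribution \<tau> a) n + measure_cumulant (distribution \<tau> b) n)"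
    using distribution_spec(1)[OF assms(3)] by blast
  fix M assume M: "compact_real_distribution M \<and> (\<forall>n\<ge>1. measure_cumulant M n =
      measure_cumulant (distribution \<tau> a) n + measure_cumulant (distribution \<tau> b) n)"
  show "M = distribution \<tau> c"
    by (rule compact_real_distribution_cumulant_unique)
      (use M distribution_spec(1)[OF assms(3)] * in auto)
qed

end

section \<open>The Schwinger--Dyson equation for a semicircular element\<close>

lemma unital_subalgebra_hull: "unital_subalgebra (unital_subalgebra hull S)"
  by (rule hull_in) (fastforce simp: unital_subalgebra_def)

lemma unital_subalgebraD:
  assumes "unital_subalgebra B"
  shows "1 \<in> B" "x \<in> B \<Longrightarrow> y \<in> B \<Longrightarrow> x + y \<in> B" "x \<in> B \<Longrightarrow> y \<in> B \<Longrightarrow> x * y \<in> B"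
    "x \<in> B \<Longrightarrow> c *\<^sub>C x \<in> B"
  using assms by (auto simp: unital_subalgebra_def)

text \<open>Semicircularity enters as the relation
  \<open>\<tau>(s w) = v (\<tau> \<otimes> \<tau>)(\<partial>w)\<close> for \<open>w = s^n\<close>,
  which the following lemmas extend to all polynomials in \<open>s\<close> and
  \<open>x\<close>.\<close>

locale free_semicircular = cstar_prob_space \<tau> for \<tau> :: "'a::cstar_algebra \<Rightarrow> complex" +
  fixes s x :: 'a and v :: complex
  assumes free: "free_elems \<tau> s x"
    and semicircle: "\<tau> (s ^ Suc n) = v * (\<Sum>i<n. \<tau> (s ^ i) * \<tau> (s ^ (n - 1 - i)))"
begin

definition alg :: "bool \<Rightarrow> 'a set" where
  "alg i = unital_subalgebra hull {if i then s else x}"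

lemma alg_subalgebra: "unital_subalgebra (alg i)"
  unfolding alg_def by (rule unital_subalgebra_hull)

lemmas alg_one = unital_subalgebraD(1)[OF alg_subalgebra]
  and alg_add = unital_subalgebraD(2)[OF alg_subalgebra]
  and alg_mult = unital_subalgebraD(3)[OF alg_subalgebra]
  and alg_scaleC = unital_subalgebraD(4)[OF alg_subalgebra]

lemma alg_diff_scalar: "a \<in> alg i \<Longrightarrow> a - c *\<^sub>C 1 \<in> alg i"
  using alg_add[of a i "(- c) *\<^sub>C 1"] alg_scaleC[OF alg_one, of "- c"] by (simp add: scaleC_minus_left)

lemma s_alg: "s \<in> alg True" and x_alg: "x \<in> alg False"
  by (simp_all add: alg_def hull_inc)

lemma power_alg: "a \<in> alg i \<Longrightarrow> a ^ n \<in> alg i"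
  by (induction n) (auto intro: alg_one alg_mult)

section \<open>Alternating words of centred elements\<close>

definition val :: "(bool \<times> 'a) list \<Rightarrow> 'a" where
  "val ws = prod_list (map snd ws)"

lemma val_simps [simp]: "val [] = 1" "val (w # ws) = snd w * val ws" "val (us @ ws) = val us * val ws"
  by (simp_all add: val_def)

definition alternating :: "(bool \<times> 'a) list \<Rightarrow> bool" where
  "alternating ws \<longleftrightarrow> distinct_adj (map fst ws) \<and> (\<forall>(i, a)\<in>set ws. a \<in> alg i \<and> \<tau> a = 0)"

lemma state_alternating: "alternating ws \<Longrightarrow> ws \<noteq> [] \<Longrightarrow> \<tau> (val ws) = 0"
  using free unfolding free_elems_def free_family_def alternating_def val_def alg_def by blast

lemma alternating_Cons:
  "alternating ((i, a) # ws) \<longleftrightarrow>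
     a \<in> alg i \<and> \<tau> a = 0 \<and> alternating ws \<and> (ws \<noteq> [] \<longrightarrow> fst (hd ws) \<noteq> i)"
  by (cases ws) (auto simp: alternating_def)

text \<open>Centring \<open>a\<close> makes the longer word alternating, and the correction
  \<open>\<tau> a * \<tau> (val ws)\<close> is zero as well.\<close>

lemma state_alternating_left:
  assumes "alternating ws" "ws \<noteq> []" "fst (hd ws) \<noteq> i" "a \<in> alg i"
  shows "\<tau> (a * val ws) = 0"
proof -
  have "alternating ((i, a - \<tau> a *\<^sub>C 1) # ws)"
    using assms by (simp add: alternating_Cons alg_diff_scalar state_diff state_scaleC state_one)
  from state_alternating[OF this] have "\<tau> (a * val ws) - \<tau> a * \<tau> (val ws) = 0"
    by (simp add: left_diff_distrib mult_scaleC_left state_diff state_scaleC)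
  then show ?thesis using state_alternating[OF assms(1,2)] by simp
qed

lemma state_alternating_right:
  assumes "alternating ws" "ws \<noteq> []" "fst (last ws) \<noteq> i" "a \<in> alg i"
  shows "\<tau> (val ws * a) = 0"
proof -
  have "alternating (ws @ [(i, a - \<tau> a *\<^sub>C 1)])"
    using assms by (auto simp: alternating_def distinct_adj_append_iff last_map
        alg_diff_scalar state_diff state_scaleC state_one)
  from state_alternating[OF this] have "\<tau> (val ws * a) - \<tau> a * \<tau> (val ws) = 0"
    by (simp add: right_diff_distrib mult_scaleC_right state_diff state_scaleC)
  then show ?thesis using state_alternating[OF assms(1,2)] by simp
qed

text \<open>
  A formal noncommutative polynomial in \<open>s\<close> with coefficients in \<open>alg False\<close> is represented by
  its value \<open>w\<close> together with the form \<open>\<Phi> p q = (\<tau> \<otimes> \<tau>) ((p \<otimes> 1) (\<partial>w) (1 \<otimes> q))\<close>, where \<open>\<partial>\<close> is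
  the free difference quotient with respect to \<open>s\<close>. Carrying \<open>\<Phi>\<close> along avoids having to show
  that \<open>\<partial>w\<close> depends only on the value \<open>w\<close>.
\<close>

inductive letter :: "bool \<Rightarrow> 'a \<Rightarrow> ('a \<Rightarrow> 'a \<Rightarrow> complex) \<Rightarrow> bool" where
  coeff: "b \<in> alg False \<Longrightarrow> letter False b (\<lambda>p q. 0)"
| power: "letter True (s ^ n) (\<lambda>p q. \<Sum>i<n. \<tau> (p * s ^ i) * \<tau> (s ^ (n - 1 - i) * q))"
| add: "letter i a \<Psi> \<Longrightarrow> letter i a' \<Psi>' \<Longrightarrow> letter i (a + a') (\<lambda>p q. \<Psi> p q + \<Psi>' p q)"
| scale: "letter i a \<Psi> \<Longrightarrow> letter i (c *\<^sub>C a) (\<lambda>p q. c * \<Psi> p q)"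

lemma letter_alg: "letter i a \<Psi> \<Longrightarrow> a \<in> alg i"
  by (induction rule: letter.induct) (auto intro: alg_add alg_scaleC power_alg s_alg)

lemma letter_linear:
  assumes "letter i a \<Psi>"
  shows "\<Psi> (p + p') q = \<Psi> p q + \<Psi> p' q" "\<Psi> (c *\<^sub>C p) q = c * \<Psi> p q"
  using assms
  by (induction arbitrary: p p' c rule: letter.induct)
    (auto simp: distrib_right state_add sum.distrib algebra_simps mult_scaleC_left state_scaleC
      sum_distrib_left)

text \<open>Every summand of the form is a product \<open>\<tau>(p u) \<tau>(u' q)\<close> with
  powers \<open>u\<close>, \<open>u'\<close> of \<open>s\<close>, so it is enough that one side
  annihilates \<open>alg True\<close>.\<close>

lemma letter_eq_0:
  assumes "letter i a \<Psi>" "(\<forall>u\<in>alg True. \<tau> (p * u) = 0) \<or> (\<forall>u\<in>alg True. \<tau> (u * q) = 0)"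
  shows "\<Psi> p q = 0"
  using assms
proof (induction rule: letter.induct)
  case (power n)
  have "\<tau> (p * s ^ i) * \<tau> (s ^ (n - 1 - i) * q) = 0" for i
    using power power_alg[OF s_alg] by auto
  then show ?case by (simp only: sum.neutral_const)
qed auto

lemma letter_False_eq_0: "letter i a \<Psi> \<Longrightarrow> \<not> i \<Longrightarrow> \<Psi> p q = 0"
  by (induction rule: letter.induct) auto

lemma letter_semicircle:
  assumes "letter i a \<Psi>" "i"
  shows "\<tau> (s * a) = v * \<Psi> 1 1"
  using assms
proof (induction rule: letter.induct)
  case (power n)
  then show ?case using semicircle[of n] by simp
qed (auto simp: distrib_left state_add mult_scaleC_right state_scaleC)

text \<open>Constants have derivative zero, so centring a letter leaves its form unchanged.\<close>

lemma letter_diff_scalar: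
  assumes "letter i a \<Psi>"
  shows "letter i (a - c *\<^sub>C 1) \<Psi>"
proof -
  have "letter i 1 (\<lambda>p q. 0)"
  proof (cases i)
    case True
    then show ?thesis using letter.power[of 0] by simp
  next
    case False
    then show ?thesis using letter.coeff[OF alg_one] by simp
  qed
  from letter.add[OF assms letter.scale[OF this, of "- c"]] show ?thesis
    by (simp add: scaleC_minus_left)
qed

text \<open>The product rule inside one algebra:
  \<open>\<partial>(s a) = 1 \<otimes> a + s \<partial>a\<close> and
  \<open>\<partial>(b a) = b \<partial>a\<close>.\<close>

lemma letter_mult:
  assumes "letter i a \<Psi>"
  shows "i \<Longrightarrow> letter True (s * a) (\<lambda>p q. \<tau> p * \<tau> (a * q) + \<Psi> (p * s) q)"
    and "\<not> i \<Longrightarrow> b \<in> alg False \<Longrightarrow> letter False (b * a) (\<lambda>p q. \<Psi> (p * b) q)"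
proof -
  show "letter True (s * a) (\<lambda>p q. \<tau> p * \<tau> (a * q) + \<Psi> (p * s) q)" if "i"
    using assms that
  proof (induction rule: letter.induct)
    case (power n)
    have "(\<lambda>p q. \<Sum>i<Suc n. \<tau> (p * s ^ i) * \<tau> (s ^ (Suc n - 1 - i) * q)) =
        (\<lambda>p q. \<tau> p * \<tau> (s ^ n * q) + (\<Sum>i<n. \<tau> (p * s * s ^ i) * \<tau> (s ^ (n - 1 - i) * q)))"
      by (intro ext, subst sum.lessThan_Suc_shift) (simp add: mult.assoc)
    then show ?case using letter.power[of "Suc n"] by simp
  next
    case (add i a \<Psi> a' \<Psi>')
    have "(\<lambda>p q. \<tau> p * \<tau> ((a + a') * q) + (\<Psi> (p * s) q + \<Psi>' (p * s) q)) =
        (\<lambda>p q. (\<tau> p * \<tau> (a * q) + \<Psi> (p * s) q) + (\<tau> p * \<tau> (a' * q) + \<Psi>' (p * s) q))"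
      by (simp add: fun_eq_iff distrib_right state_add algebra_simps)
    then show ?case using letter.add[OF add.IH] add.prems by (simp add: distrib_left)
  next
    case (scale i a \<Psi> c)
    have "(\<lambda>p q. \<tau> p * \<tau> (c *\<^sub>C a * q) + c * \<Psi> (p * s) q) =
        (\<lambda>p q. c * (\<tau> p * \<tau> (a * q) + \<Psi> (p * s) q))"
      by (simp add: fun_eq_iff mult_scaleC_left state_scaleC algebra_simps)
    then show ?case using letter.scale[OF scale.IH, of c] scale.prems by (simp add: mult_scaleC_right)
  qed simp
  show "letter False (b * a) (\<lambda>p q. \<Psi> (p * b) q)" if "\<not> i" "b \<in> alg False"
    using assms that
  proof (induction rule: letter.induct)
    case (coeff a)
    then show ?case by (intro letter.coeff alg_mult)
  next
    case (add i a \<Psi> a' \<Psi>')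
    then show ?case using letter.add[OF add.IH] by (simp add: distrib_left)
  next
    case (scale i a \<Psi> c)
    then show ?case using letter.scale[OF scale.IH, of c] by (simp add: mult_scaleC_right)
  qed simp
qed

text \<open>The form follows the product rule: the derivative hits either the first letter, with the
  remaining word moved to the right argument, or the remaining word, with the letter moved to the
  left argument.\<close>

inductive centred_word :: "(bool \<times> 'a) list \<Rightarrow> ('a \<Rightarrow> 'a \<Rightarrow> complex) \<Rightarrow> bool" where
  Nil: "centred_word [] (\<lambda>p q. 0)"
| Cons: "centred_word ws \<Phi> \<Longrightarrow> (ws \<noteq> [] \<longrightarrow> fst (hd ws) \<noteq> i) \<Longrightarrow> letter i a \<Psi> \<Longrightarrow> \<tau> a = 0 \<Longrightarrow>
    centred_word ((i, a) # ws) (\<lambda>p q. \<Psi> p (val ws * q) + \<Phi> (p * a) q)"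

lemma centred_word_alternating: "centred_word ws \<Phi> \<Longrightarrow> alternating ws"
proof (induction rule: centred_word.induct)
  case Nil
  then show ?case by (simp add: alternating_def)
next
  case (Cons ws \<Phi> i a \<Psi>)
  then show ?case by (simp add: alternating_Cons letter_alg)
qed

lemma centred_word_linear:
  assumes "centred_word ws \<Phi>"
  shows "\<Phi> (p + p') q = \<Phi> p q + \<Phi> p' q" "\<Phi> (c *\<^sub>C p) q = c * \<Phi> p q"
  using assms
  by (induction arbitrary: p p' c rule: centred_word.induct)
    (auto simp: letter_linear distrib_right mult_scaleC_left algebra_simps)

text \<open>A letter from \<open>alg False\<close> has form zero. A letter from
  \<open>alg True\<close> is preceded by a prefix ending in \<open>alg False\<close>, which
  annihilates \<open>alg True\<close> by freeness. Absorbing the letter into the prefix gives the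
  induction.\<close>

lemma centred_word_prefix_eq_0:
  assumes "centred_word ws \<Phi>" "us \<noteq> []" "alternating (us @ ws)"
  shows "\<Phi> (val us) 1 = 0"
  using assms
proof (induction arbitrary: us rule: centred_word.induct)
  case (Cons ws \<Phi> i a \<Psi>)
  have us: "alternating us" "fst (last us) \<noteq> i"
    using Cons.prems by (auto simp: alternating_def distinct_adj_append_iff last_map)
  have "\<Psi> (val us) (val ws * 1) = 0"
  proof (cases i)
    case True
    then show ?thesis
      using letter_eq_0[OF Cons.hyps(3)] state_alternating_right[OF us(1) Cons.prems(1) us(2)] by simp
  next
    case False
    then show ?thesis by (rule letter_False_eq_0[OF Cons.hyps(3)])
  qed
  moreover have "\<Phi> (val (us @ [(i, a)])) 1 = 0"
    by (rule Cons.IH) (use Cons.prems in auto)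
  ultimately show ?case by simp
qed simp

lemma state_s: "\<tau> s = 0"
  using semicircle[of 0] by simp

text \<open>By the preceding lemma only the first letter contributes to \<open>\<Phi> 1 1\<close>.
  If it lies in \<open>alg False\<close>, both sides vanish. If it lies in \<open>alg True\<close>,
  a one-letter word is the moment recursion of \<open>s\<close>, and for a longer word both sides
  vanish because the rest annihilates \<open>alg True\<close>.\<close>

lemma schwinger_dyson_centred_word:
  assumes "centred_word ws \<Phi>"
  shows "\<tau> (s * val ws) = v * \<Phi> 1 1"
  using assms
proof cases
  case Nil
  then show ?thesis by (simp add: state_s)
next
  case (Cons ws' \<Phi>' i a \<Psi>)
  have alt: "alternating ((i, a) # ws')"
    using centred_word_alternating[OF assms] Cons(1) by simp
  then have alt': "alternating ws'" by (simp add: alternating_Cons)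
  have "\<Phi>' (val [(i, a)]) 1 = 0"
    by (rule centred_word_prefix_eq_0[OF Cons(3)]) (use alt in auto)
  then have \<Phi>: "\<Phi> 1 1 = \<Psi> 1 (val ws')" using Cons(2) by simp
  show ?thesis
  proof (cases i)
    case False
    then have "\<tau> (s * val ws) = 0"
      unfolding Cons(1) by (intro state_alternating_left[OF alt _ _ s_alg]) auto
    then show ?thesis using \<Phi> letter_False_eq_0[OF Cons(5) False] by simp
  next
    case True
    show ?thesis
    proof (cases "ws' = []")
      case nil: True
      then show ?thesis using letter_semicircle[OF Cons(5) True] \<Phi> by (simp add: Cons(1))
    next
      case nonempty: False
      then have zero: "\<tau> (u * val ws') = 0" if "u \<in> alg True" for u
        using state_alternating_left[OF alt' nonempty _ that] Cons(4) True by simp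
      have "s * a \<in> alg True" using letter_alg[OF Cons(5)] True s_alg alg_mult by simp
      from zero[OF this] have "\<tau> (s * val ws) = 0" by (simp add: Cons(1) mult.assoc)
      moreover have "\<Psi> 1 (val ws') = 0" by (rule letter_eq_0[OF Cons(5)]) (use zero in blast)
      ultimately show ?thesis using \<Phi> by simp
    qed
  qed
qed

inductive span_word :: "'a \<Rightarrow> ('a \<Rightarrow> 'a \<Rightarrow> complex) \<Rightarrow> bool" where
  word: "centred_word ws \<Phi> \<Longrightarrow> span_word (val ws) \<Phi>"
| add: "span_word w \<Phi> \<Longrightarrow> span_word w' \<Phi>' \<Longrightarrow> span_word (w + w') (\<lambda>p q. \<Phi> p q + \<Phi>' p q)"
| scale: "span_word w \<Phi> \<Longrightarrow> span_word (c *\<^sub>C w) (\<lambda>p q. c * \<Phi> p q)"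

lemma schwinger_dyson: "span_word w \<Phi> \<Longrightarrow> \<tau> (s * w) = v * \<Phi> 1 1"
  by (induction rule: span_word.induct)
    (auto simp: schwinger_dyson_centred_word distrib_left state_add mult_scaleC_right state_scaleC)

lemma span_word_zero: "span_word 0 (\<lambda>p q. 0)"
  using span_word.scale[OF span_word.word[OF centred_word.Nil], of 0] by simp

lemma span_word_one: "span_word 1 (\<lambda>p q. 0)"
  using span_word.word[OF centred_word.Nil] by simp

text \<open>
  Left multiplication of a centred word by a generator \<open>g\<close>: either \<open>g\<close> starts a new centred
  letter, or it is absorbed into the first one, which is then centred again.
\<close>

lemma span_word_mult_centred:
  assumes ws: "centred_word ws \<Phi>" and g: "letter i g \<Gamma>"
    and absorb: "\<And>a \<Psi>. letter i a \<Psi> \<Longrightarrow> letter i (g * a) (\<lambda>p q. \<Gamma> p (a * q) + \<Psi> (p * g) q)"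
  shows "span_word (g * val ws) (\<lambda>p q. \<Gamma> p (val ws * q) + \<Phi> (p * g) q)"
proof -
  have push: "span_word (h * val us) (\<lambda>p q. \<Psi> p (val us * q) + \<Theta> (p * h) q)"
    if us: "centred_word us \<Theta>" "us \<noteq> [] \<longrightarrow> fst (hd us) \<noteq> i" and h: "letter i h \<Psi>" for us \<Theta> h \<Psi>
  proof -
    let ?h = "h - \<tau> h *\<^sub>C 1"
    \<comment> \<open>Centring \<open>h\<close> splits the product into two words; linearity in the
      left argument recombines their forms.\<close>
    have lin: "\<Theta> (p * ?h) q + \<tau> h * \<Theta> p q = \<Theta> (p * h) q" for p q
      using centred_word_linear(1)[OF us(1), of "p * ?h" "\<tau> h *\<^sub>C p" q]
        centred_word_linear(2)[OF us(1), of "\<tau> h" p q]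
      by (simp add: right_diff_distrib mult_scaleC_right)
    have "centred_word ((i, ?h) # us) (\<lambda>p q. \<Psi> p (val us * q) + \<Theta> (p * ?h) q)"
      by (rule centred_word.Cons[OF us letter_diff_scalar[OF h]])
        (simp add: state_diff state_scaleC state_one)
    from span_word.add[OF span_word.word[OF this] span_word.scale[OF span_word.word[OF us(1)], of "\<tau> h"]]
    show ?thesis
      by (simp add: left_diff_distrib mult_scaleC_left add.assoc lin)
  qed
  show ?thesis
  proof (cases "ws \<noteq> [] \<and> fst (hd ws) = i")
    case False
    then show ?thesis using push[OF ws _ g] by blast
  next
    case True
    from ws show ?thesis
    proof cases
      case Nil
      then show ?thesis using True by simp
    next
      case (Cons ws' \<Phi>' j a \<Psi>)
      then have j: "j = i" using True by simp
      from push[OF Cons(3) _ absorb[OF Cons(5)[unfolded j]]] Cons(4) j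
      show ?thesis unfolding Cons(1,2) by (simp add: mult.assoc add.assoc)
    qed
  qed
qed

lemma span_word_mult_s:
  assumes "span_word w \<Phi>"
  shows "span_word (s * w) (\<lambda>p q. \<tau> p * \<tau> (w * q) + \<Phi> (p * s) q)"
  using assms
proof (induction rule: span_word.induct)
  case (word ws \<Phi>)
  have "letter True s (\<lambda>p q. \<tau> p * \<tau> q)" using letter.power[of 1] by simp
  from span_word_mult_centred[OF word this letter_mult(1)] show ?case by simp
next
  case (add w \<Phi> w' \<Phi>')
  have "(\<lambda>p q. \<tau> p * \<tau> ((w + w') * q) + (\<Phi> (p * s) q + \<Phi>' (p * s) q)) =
      (\<lambda>p q. (\<tau> p * \<tau> (w * q) + \<Phi> (p * s) q) + (\<tau> p * \<tau> (w' * q) + \<Phi>' (p * s) q))"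
    by (simp add: fun_eq_iff distrib_right state_add algebra_simps)
  then show ?case using span_word.add[OF add.IH] by (simp add: distrib_left)
next
  case (scale w \<Phi> c)
  have "(\<lambda>p q. \<tau> p * \<tau> (c *\<^sub>C w * q) + c * \<Phi> (p * s) q) =
      (\<lambda>p q. c * (\<tau> p * \<tau> (w * q) + \<Phi> (p * s) q))"
    by (simp add: fun_eq_iff mult_scaleC_left state_scaleC algebra_simps)
  then show ?case using span_word.scale[OF scale.IH, of c] by (simp add: mult_scaleC_right)
qed

lemma span_word_mult_coeff:
  assumes "span_word w \<Phi>" "b \<in> alg False"
  shows "span_word (b * w) (\<lambda>p q. \<Phi> (p * b) q)"
  using assms
proof (induction rule: span_word.induct)
  case (word ws \<Phi>)
  have "letter False (b * a) (\<lambda>p q. 0 + \<Psi> (p * b) q)" if "letter False a \<Psi>" for a \<Psi>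
    using letter_mult(2)[OF that] word by simp
  from span_word_mult_centred[OF word(1) letter.coeff[OF word(2)] this] show ?case by simp
next
  case (add w \<Phi> w' \<Phi>')
  then show ?case using span_word.add[OF add.IH] by (simp add: distrib_left)
next
  case (scale w \<Phi> c)
  then show ?case using span_word.scale[OF scale.IH, of c] by (simp add: mult_scaleC_right)
qed

section \<open>Elements linear in \<open>s\<close> with coefficients in the algebra of
  \<open>x\<close>\<close>

definition lin :: "('a \<times> 'a) list \<Rightarrow> 'a" where
  "lin L = (\<Sum>(a, c)\<leftarrow>L. a * s * c)"

lemma span_word_mult_lin:
  assumes "span_word w \<Phi>" "\<forall>(a, c)\<in>set L. a \<in> alg False \<and> c \<in> alg False"
  shows "span_word (lin L * w)
    (\<lambda>p q. (\<Sum>(a, c)\<leftarrow>L. \<tau> (p * a) * \<tau> (c * w * q)) + (\<Sum>(a, c)\<leftarrow>L. \<Phi> (p * (a * s * c)) q))"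
  using assms(2)
proof (induction L)
  case Nil
  then show ?case using span_word_zero by (simp add: lin_def)
next
  case (Cons ac L)
  obtain a c where ac: "ac = (a, c)" by (cases ac)
  have "span_word (a * (s * (c * w))) (\<lambda>p q. \<tau> (p * a) * \<tau> (c * w * q) + \<Phi> (p * a * s * c) q)"
    using span_word_mult_coeff[OF span_word_mult_s[OF span_word_mult_coeff[OF assms(1)]], of c a]
      Cons.prems by (simp add: ac)
  moreover have "span_word (lin L * w)
    (\<lambda>p q. (\<Sum>(a, c)\<leftarrow>L. \<tau> (p * a) * \<tau> (c * w * q)) + (\<Sum>(a, c)\<leftarrow>L. \<Phi> (p * (a * s * c)) q))"
    using Cons by simp
  ultimately have "span_word (a * (s * (c * w)) + lin L * w)
    (\<lambda>p q. (\<tau> (p * a) * \<tau> (c * w * q) + \<Phi> (p * a * s * c) q) +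
      ((\<Sum>(a, c)\<leftarrow>L. \<tau> (p * a) * \<tau> (c * w * q)) + (\<Sum>(a, c)\<leftarrow>L. \<Phi> (p * (a * s * c)) q)))"
    by (rule span_word.add)
  then show ?case by (simp add: ac lin_def distrib_right mult.assoc add_ac)
qed

lemma sum_list_state_mult: "(\<Sum>(a, c)\<leftarrow>L. \<tau> (p * (a * s * c) * r)) = \<tau> (p * lin L * r)"
  by (induction L) (auto simp: lin_def distrib_left distrib_right state_add)

text \<open>For \<open>z = lin L\<close> this is
  \<open>\<partial>(z^n b) = \<Sum>j<n. z^j (\<partial>z) z^(n-1-j) b\<close>, where
  \<open>\<partial>z\<close> is the sum of all \<open>a \<otimes> c\<close>.\<close>

lemma span_word_lin_power:
  assumes L: "\<forall>(a, c)\<in>set L. a \<in> alg False \<and> c \<in> alg False" and b: "b \<in> alg False"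
  shows "span_word (lin L ^ n * b) (\<lambda>p q. \<Sum>j<n. \<Sum>(a, c)\<leftarrow>L.
    \<tau> (p * lin L ^ j * a) * \<tau> (c * lin L ^ (n - 1 - j) * b * q))"
proof (induction n)
  case 0
  then show ?case using span_word_mult_coeff[OF span_word_one b] by simp
next
  case (Suc n)
  let ?z = "lin L"
  let ?\<Phi> = "\<lambda>p q. \<Sum>j<n. \<Sum>(a, c)\<leftarrow>L. \<tau> (p * ?z ^ j * a) * \<tau> (c * ?z ^ (n - 1 - j) * b * q)"
  \<comment> \<open>The list \<open>M\<close> is separate from \<open>L\<close> because
    \<open>?\<Phi>\<close> depends on \<open>L\<close>, which must stay fixed during the
    induction.\<close>
  have shift: "(\<Sum>(a', c')\<leftarrow>M. ?\<Phi> (p * (a' * s * c')) q) = ?\<Phi> (p * lin M) q" for M p q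
  proof (induction M)
    case Nil
    then show ?case by (simp add: lin_def case_prod_unfold)
  next
    case (Cons m M)
    have "?\<Phi> (u + u') q = ?\<Phi> u q + ?\<Phi> u' q" for u u'
      by (simp add: distrib_right state_add case_prod_unfold sum_list_addf sum.distrib)
    then show ?case using Cons by (simp add: lin_def case_prod_unfold distrib_left)
  qed
  have "(\<Sum>(a, c)\<leftarrow>L. \<tau> (p * a) * \<tau> (c * (?z ^ n * b) * q)) + ?\<Phi> (p * ?z) q =
      (\<Sum>j<Suc n. \<Sum>(a, c)\<leftarrow>L. \<tau> (p * ?z ^ j * a) * \<tau> (c * ?z ^ (Suc n - 1 - j) * b * q))" for p q
    by (subst sum.lessThan_Suc_shift) (simp add: mult.assoc case_prod_unfold)
  moreover have "span_word (?z * (?z ^ n * b))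
      (\<lambda>p q. (\<Sum>(a, c)\<leftarrow>L. \<tau> (p * a) * \<tau> (c * (?z ^ n * b) * q)) + ?\<Phi> (p * ?z) q)"
    using span_word_mult_lin[OF Suc L] unfolding shift .
  ultimately show ?case by (simp only: power_Suc mult.assoc[of ?z])
qed

lemma state_rotate: "\<tau> (p * q * r) = \<tau> (r * p * q)"
  by (metis mult.assoc state_tracial)

text \<open>One factor \<open>z\<close> is expanded into its terms \<open>a' s c'\<close>, the trace
  rotates \<open>s\<close> to the front, and the Schwinger-Dyson equation is applied to
  \<open>c' z^n b a'\<close>. Rotating back leaves the covariance of \<open>z\<close> in terms of
  moments.\<close>

lemma state_lin_power_Suc:
  assumes L: "\<forall>(a, c)\<in>set L. a \<in> alg False \<and> c \<in> alg False" and b: "b \<in> alg False"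
  shows "\<tau> (b * lin L ^ Suc n) = v * (\<Sum>j<n. \<Sum>(a', c')\<leftarrow>L. \<Sum>(a, c)\<leftarrow>L.
    \<tau> (a * c' * lin L ^ j) * \<tau> (b * a' * c * lin L ^ (n - 1 - j)))"
proof -
  let ?z = "lin L"
  let ?S = "\<lambda>a' c'. \<Sum>j<n. \<Sum>(a, c)\<leftarrow>L. \<tau> (a * c' * ?z ^ j) * \<tau> (b * a' * c * ?z ^ (n - 1 - j))"
  have one: "\<tau> (b * (a' * s * c') * ?z ^ n) = v * ?S a' c'" if "(a', c') \<in> set L" for a' c'
  proof -
    have B: "a' \<in> alg False" "c' \<in> alg False" "b * a' \<in> alg False"
      using L b that alg_mult by auto
    have "\<tau> (b * (a' * s * c') * ?z ^ n) = \<tau> ((b * a') * (s * (c' * ?z ^ n)))"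
      by (simp add: mult.assoc)
    also have "\<dots> = \<tau> (s * (c' * (?z ^ n * (b * a'))))"
      by (subst state_tracial) (simp add: mult.assoc)
    also have "\<dots> = v * (\<Sum>j<n. \<Sum>(a, c)\<leftarrow>L. \<tau> (c' * ?z ^ j * a) * \<tau> (c * ?z ^ (n - 1 - j) * (b * a')))"
      using schwinger_dyson[OF span_word_mult_coeff[OF span_word_lin_power[OF L B(3)] B(2)]] by simp
    also have "(\<lambda>j. \<lambda>(a, c). \<tau> (c' * ?z ^ j * a) * \<tau> (c * ?z ^ (n - 1 - j) * (b * a'))) =
        (\<lambda>j. \<lambda>(a, c). \<tau> (a * c' * ?z ^ j) * \<tau> (b * a' * c * ?z ^ (n - 1 - j)))"
      by (intro ext) (simp add: split_beta state_rotate[of c'] state_rotate[of _ _ "b * a'"])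
    finally show ?thesis .
  qed
  have "\<tau> (b * ?z ^ Suc n) = (\<Sum>(a', c')\<leftarrow>L. \<tau> (b * (a' * s * c') * ?z ^ n))"
    unfolding sum_list_state_mult by (simp add: mult.assoc)
  also have "\<dots> = (\<Sum>(a', c')\<leftarrow>L. v * ?S a' c')"
    using one by (intro arg_cong[of _ _ sum_list] map_cong) auto
  also have "\<dots> = v * (\<Sum>j<n. \<Sum>(a', c')\<leftarrow>L. \<Sum>(a, c)\<leftarrow>L.
    \<tau> (a * c' * ?z ^ j) * \<tau> (b * a' * c * ?z ^ (n - 1 - j)))"
    unfolding case_prod_unfold sum_list_const_mult
    by (simp add: sum_list_sum_nth sum.swap[of _ "{..<n}"])
  finally show ?thesis .
qed

end

section \<open>Adding a commutator\<close>

context cstar_prob_space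
begin

text \<open>The cumulant series is \<open>1 + v t^2\<close>, so the functional equation becomes
  \<open>M = 1 + v t^2 M^2\<close>; coefficients are compared.\<close>

lemma semicircular_moment_recursion:
  assumes "semicircular \<tau> s"
  shows "\<tau> (s ^ Suc n) = elem_cumulant \<tau> s 2 * (\<Sum>i<n. \<tau> (s ^ i) * \<tau> (s ^ (n - 1 - i)))"
proof -
  define v where "v = elem_cumulant \<tau> s 2"
  define m where "m k = \<tau> (s ^ k)" for k
  define F where "F = Abs_fps m"
  have "cumulant_fps m = 1 + fps_const v * fps_X\<^sup>2"
  proof (rule fps_ext)
    fix k
    have "elem_cumulant \<tau> s k = 0" if "k \<ge> 1" "k \<noteq> 2" using assms that by (simp add: semicircular_def)
    then show "cumulant_fps m $ k = (1 + fps_const v * fps_X\<^sup>2) $ k"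
      by (cases "k = 0"; cases "k = 2")
        (auto simp: cumulant_fps_def m_def[abs_def] v_def elem_cumulant_def fps_X_power_nth)
  qed
  moreover have "cumulant_fps m oo (fps_X * F) = F"
    unfolding F_def by (rule moment_cumulant_fps) (simp add: m_def state_one)
  ultimately have "(1 + fps_const v * fps_X\<^sup>2) oo (fps_X * F) = F" by simp
  moreover have "(1 + fps_const v * fps_X\<^sup>2) oo (fps_X * F) = 1 + fps_const v * (fps_X * F)\<^sup>2"
  proof -
    have 0: "(fps_X * F) $ 0 = 0" by simp
    show ?thesis
      by (simp add: fps_compose_add_distrib fps_compose_mult_distrib[OF 0]
          power2_eq_square fps_X_compose_eq[OF 0])
  qed
  ultimately have F: "F = 1 + fps_X\<^sup>2 * (fps_const v * (F * F))"
    by (simp add: power2_eq_square mult_ac)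
  have "F $ Suc n = v * (\<Sum>i<n. m i * m (n - 1 - i))"
  proof (cases n)
    case 0
    then show ?thesis by (subst F) (simp add: fps_X_power_mult_nth)
  next
    case (Suc k)
    have "F $ Suc n = v * (F * F) $ k"
      by (subst F) (simp add: fps_X_power_mult_nth Suc)
    then show ?thesis
      by (simp add: fps_mult_nth F_def Suc atLeast0AtMost lessThan_Suc_atMost)
  qed
  then show ?thesis by (simp add: F_def m_def v_def)
qed

lemma state_self_adjoint_real:
  assumes "self_adjoint a"
  shows "cnj (\<tau> a) = \<tau> a"
  using distribution_spec(2)[OF assms, of 1] by (metis complex_cnj_complex_of_real power_one_right)

end

section \<open>Moments and cumulants of the commutator and of its sum with \<open>s\<close>\<close>

context free_semicircular
begin

context
  fixes e :: complex and z :: 'a and f :: "nat \<Rightarrow> nat \<Rightarrow> complex"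
  defines "z \<equiv> e *\<^sub>C s + \<i> *\<^sub>C commutator s x"
    and "f \<equiv> \<lambda>k n. \<tau> (x ^ k * z ^ n)"
begin

text \<open>The values \<open>e = 0\<close> and \<open>e = 1\<close> give the commutator and its sum
  with \<open>s\<close>. Of the nine products of coefficient pairs, the four linear in
  \<open>e\<close> cancel in pairs, which is why \<open>s\<close> contributes only the term with
  \<open>e\<^sup>2\<close>.\<close>

lemma moment_recursion:
  "f k (Suc n) = v * (\<Sum>j<n. e\<^sup>2 * (f 0 j * f k (n - 1 - j)) +
    (f 2 j * f k (n - 1 - j) - 2 * (f 1 j * f (Suc k) (n - 1 - j)) + f 0 j * f (Suc (Suc k)) (n - 1 - j)))"
proof -
  let ?L = "[(e *\<^sub>C 1, 1), (\<i> *\<^sub>C 1, x), (- \<i> *\<^sub>C x, 1)] :: ('a \<times> 'a) list"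
  have z: "z = lin ?L"
    by (simp add: z_def lin_def commutator_def mult_scaleC_left scaleC_diff_right scaleC_minus_left)
  have "\<forall>(a, c)\<in>set ?L. a \<in> alg False \<and> c \<in> alg False"
    using alg_one[of False] x_alg alg_scaleC[of _ False] by simp
  note expand = state_lin_power_Suc[OF this power_alg[OF x_alg, of k], folded z]
  have xk: "x ^ k * (x * r) = x * (x ^ k * r)" for r
    by (metis mult.assoc power_commutes)
  from expand have "f k (Suc n) = v * (\<Sum>j<n. \<Sum>(a', c')\<leftarrow>?L. \<Sum>(a, c)\<leftarrow>?L.
      \<tau> (a * c' * z ^ j) * \<tau> (x ^ k * a' * c * z ^ (n - 1 - j)))"
    by (simp add: f_def)
  also have "(\<lambda>j. \<Sum>(a', c')\<leftarrow>?L. \<Sum>(a, c)\<leftarrow>?L.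
      \<tau> (a * c' * z ^ j) * \<tau> (x ^ k * a' * c * z ^ (n - 1 - j))) =
    (\<lambda>j. e\<^sup>2 * (f 0 j * f k (n - 1 - j)) +
    (f 2 j * f k (n - 1 - j) - 2 * (f 1 j * f (Suc k) (n - 1 - j)) + f 0 j * f (Suc (Suc k)) (n - 1 - j)))"
    by (intro ext) (simp add: f_def mult_scaleC_left mult_scaleC_right state_scaleC
        scaleC_minus_left state_minus power2_eq_square xk algebra_simps)
  finally show ?thesis .
qed

lemma moment_fps_equation:
  "Abs_fps (f k) = fps_const (\<tau> (x ^ k)) + fps_const v * fps_X\<^sup>2 *
    (fps_const (e\<^sup>2) * (Abs_fps (f 0) * Abs_fps (f k)) + (Abs_fps (f 2) * Abs_fps (f k)
      - 2 * (Abs_fps (f 1) * Abs_fps (f (Suc k))) + Abs_fps (f 0) * Abs_fps (f (Suc (Suc k)))))"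
    (is "_ = _ + _ * _ * ?G")
proof (rule fps_ext)
  fix n
  show "Abs_fps (f k) $ n = (fps_const (\<tau> (x ^ k)) + fps_const v * fps_X\<^sup>2 * ?G) $ n"
  proof (cases "n < 2")
    case True
    then consider "n = 0" | "n = 1" by linarith
    then show ?thesis
    proof cases
      case 1
      then show ?thesis by (simp add: f_def power2_eq_square mult.assoc)
    next
      case 2
      \<comment> \<open>In degree 1 the series side is zero because of the factor
        \<open>t^2\<close>, and the recursion at \<open>n = 0\<close> has an empty sum.\<close>
      have "(fps_const v * fps_X\<^sup>2 * ?G) $ 1 = (fps_X\<^sup>2 * (fps_const v * ?G)) $ 1"
        by (simp only: mult_ac)
      also have "\<dots> = 0" by (subst fps_X_power_mult_nth) simp
      finally show ?thesis using 2 moment_recursion[of k 0] by simp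
    qed
  next
    case False
    then obtain l where l: "n = Suc (Suc l)" by (metis add_2_eq_Suc le_Suc_ex not_less)
    have "(fps_const v * fps_X\<^sup>2 * ?G) $ n = (fps_X\<^sup>2 * (fps_const v * ?G)) $ n"
      by (simp only: mult_ac)
    also have "\<dots> = v * ?G $ l" by (subst fps_X_power_mult_nth) (simp add: l)
    also have "?G $ l = (\<Sum>j\<le>l. e\<^sup>2 * (f 0 j * f k (l - j)) + (f 2 j * f k (l - j)
        - 2 * (f 1 j * f (Suc k) (l - j)) + f 0 j * f (Suc (Suc k)) (l - j)))"
    proof -
      have "(Abs_fps g * Abs_fps h) $ l = (\<Sum>j\<le>l. g j * h (l - j))" for g h :: "nat \<Rightarrow> complex"
        by (simp add: fps_mult_nth atLeast0AtMost)
      then show ?thesis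
        by (simp add: numeral_fps_const sum.distrib sum_subtractf sum_distrib_left)
    qed
    finally show ?thesis
      using moment_recursion[of k "Suc l"] by (simp add: l lessThan_Suc_atMost)
  qed
qed

end

text \<open>The moment equations for \<open>e = 0\<close> and \<open>e = 1\<close> are the two
  systems of \<open>cumulant_fps_add_from_system\<close>.\<close>

lemma cumulant_add_commutator:
  assumes "n \<ge> 1"
  shows "elem_cumulant \<tau> (s + \<i> *\<^sub>C commutator s x) n =
    elem_cumulant \<tau> (\<i> *\<^sub>C commutator s x) n + (if n = 2 then v else 0)"
proof -
  define m where "m z k l = \<tau> (x ^ k * z ^ l)" for z k l
  let ?y = "\<i> *\<^sub>C commutator s x" and ?z = "s + \<i> *\<^sub>C commutator s x"
  have m0: "m w 0 = (\<lambda>k. \<tau> (w ^ k))" "m w 0 0 = 1" for w by (auto simp: m_def state_one)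
  have "cumulant_fps (m ?z 0) = cumulant_fps (m ?y 0) + fps_const v * fps_X\<^sup>2"
  proof (rule cumulant_fps_add_from_system)
    fix k
    show "Abs_fps (m ?y k) = fps_const (\<tau> (x ^ k)) + fps_const v * fps_X\<^sup>2 *
        (Abs_fps (m ?y 2) * Abs_fps (m ?y k) - 2 * (Abs_fps (m ?y 1) * Abs_fps (m ?y (Suc k))) +
          Abs_fps (m ?y 0) * Abs_fps (m ?y (Suc (Suc k))))"
      using moment_fps_equation[where e = 0 and k = k] by (simp add: m_def[abs_def])
    show "Abs_fps (m ?z k) = fps_const (\<tau> (x ^ k)) + fps_const v * fps_X\<^sup>2 *
        (Abs_fps (m ?z 0) * Abs_fps (m ?z k) + (Abs_fps (m ?z 2) * Abs_fps (m ?z k) -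
          2 * (Abs_fps (m ?z 1) * Abs_fps (m ?z (Suc k))) + Abs_fps (m ?z 0) * Abs_fps (m ?z (Suc (Suc k)))))"
      using moment_fps_equation[where e = 1 and k = k] by (simp add: m_def[abs_def])
  qed (simp_all add: state_one moment_cumulant_fps m0(2))
  from arg_cong[OF this, of "\<lambda>h. h $ n"] show ?thesis
    using assms by (simp add: cumulant_fps_def elem_cumulant_def m0(1) fps_X_power_nth)
qed

text \<open>For scalar \<open>x\<close> the commutator is 0, which is free from \<open>s\<close>,
  hence the assumption. Otherwise the fourth mixed moment \<open>\<tau>(s y s y)\<close> is nonzero,
  by faithfulness.\<close>

lemma not_free_commutator:
  assumes x: "self_adjoint x" and v: "v \<noteq> 0" and nonscalar: "\<nexists>c. x = c *\<^sub>C 1"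
  shows "\<not> free_elems \<tau> s (\<i> *\<^sub>C commutator s x)"
proof
  let ?y = "\<i> *\<^sub>C commutator s x"
  assume "free_elems \<tau> s ?y"
  moreover have "\<tau> ?y = 0"
    by (simp add: state_scaleC commutator_def state_diff state_tracial[of s x])
  moreover have "s \<in> unital_subalgebra hull {s}" "?y \<in> unital_subalgebra hull {?y}"
    by (simp_all add: hull_inc)
  ultimately have zero: "\<tau> (s * (?y * (s * ?y))) = 0"
    unfolding free_elems_def free_family_def
    by (auto simp: state_s dest!: spec[of _ "[(True, s), (False, ?y), (True, s), (False, ?y)]"])
  \<comment> \<open>Commutators do not see scalars, so \<open>x\<close> may be replaced by its
    centred version.\<close>
  define w where "w = x - \<tau> x *\<^sub>C 1"
  have w: "w \<in> alg False" "\<tau> w = 0"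
    by (simp_all add: w_def alg_diff_scalar x_alg state_diff state_scaleC state_one)
  have y: "?y = \<i> *\<^sub>C (s * w - w * s)"
    by (simp add: w_def commutator_def algebra_simps mult_scaleC_left mult_scaleC_right)
  have s2: "\<tau> (s * s) = v" using semicircle[of 1] by (simp add: state_one)
  have s3: "\<tau> (s * s * s) = 0"
    using semicircle[of 2] by (simp add: state_s numeral_2_eq_2 mult.assoc)
  \<comment> \<open>The odd powers \<open>s\<close> and \<open>s^3\<close> are centred already; only
    \<open>s^2\<close> has to be corrected by its mean \<open>v\<close>.\<close>
  define c where "c = s * s - v *\<^sub>C 1"
  have c: "c \<in> alg True" "\<tau> c = 0"
    by (simp_all add: c_def alg_diff_scalar alg_mult s_alg state_diff state_scaleC state_one s2)
  have t1: "\<tau> (s * s * s * w * s * w) = 0"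
    using state_alternating[of "[(True, s * s * s), (False, w), (True, s), (False, w)]"] w s3 state_s
    by (simp add: alternating_Cons alternating_def alg_mult s_alg mult.assoc)
  have t2: "\<tau> (s * s * w * (s * s) * w) = v\<^sup>2 * \<tau> (w * w)"
  proof -
    have "\<tau> (c * w * c * w) = 0"
      using state_alternating[of "[(True, c), (False, w), (True, c), (False, w)]"] w c
      by (simp add: alternating_Cons alternating_def mult.assoc)
    moreover have cww: "\<tau> (c * w * w) = 0"
      using state_alternating_right[of "[(True, c)]" False "w * w"] w c
      by (simp add: alternating_Cons alternating_def alg_mult mult.assoc)
    moreover have "\<tau> (w * c * w) = 0" using cww state_rotate[of w c w] state_rotate[of c w w] by simp
    moreover have ss: "s * s = c + v *\<^sub>C 1" by (simp add: c_def)
    ultimately show ?thesis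
      unfolding ss
      by (simp add: distrib_left distrib_right mult_scaleC_left mult_scaleC_right state_add
          state_scaleC power2_eq_square mult.assoc)
  qed
  \<comment> \<open>The sign is the square of the imaginary unit. Up to cyclic rotation two of the
    four words are that of \<open>t1\<close> and vanish, and the other two are that of
    \<open>t2\<close>.\<close>
  have "s * (?y * (s * ?y)) = - (s * s * w * (s * s) * w - s * s * w * s * w * s
      - s * w * (s * s * s) * w + s * w * (s * s) * w * s)"
    unfolding y mult_scaleC_left mult_scaleC_right scaleC_scaleC
    by (simp add: scaleC_minus_one algebra_simps)
  then have "\<tau> (s * (?y * (s * ?y))) = - (\<tau> (s * s * w * (s * s) * w) - \<tau> (s * s * w * s * w * s)
      - \<tau> (s * w * (s * s * s) * w) + \<tau> (s * w * (s * s) * w * s))"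
    by (simp add: state_minus state_diff state_add)
  also have "\<tau> (s * s * w * s * w * s) = 0"
    using t1 state_tracial[of "s * s * w * s * w" s] by (simp add: mult.assoc)
  also have "\<tau> (s * w * (s * s * s) * w) = 0"
    using t1 state_tracial[of "s * w" "s * s * s * w"] by (simp add: mult.assoc)
  also have "\<tau> (s * w * (s * s) * w * s) = v\<^sup>2 * \<tau> (w * w)"
    using t2 state_tracial[of "s * w * (s * s) * w" s] by (simp add: mult.assoc)
  finally have "\<tau> (w * w) = 0" using zero t2 v by simp
  \<comment> \<open>As \<open>\<tau> x\<close> is real, \<open>w\<close> is self-adjoint and
    \<open>w * w\<close> is of the form required by faithfulness.\<close>
  moreover have "adj w = w"
    using x state_self_adjoint_real[OF x] by (simp add: w_def self_adjoint_def adj_diff adj_scaleC)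
  ultimately have "w = 0" using state_faithful[of w] by simp
  then show False using nonscalar by (auto simp: w_def)
qed

end

lemma self_adjoint_add: "self_adjoint a \<Longrightarrow> self_adjoint b \<Longrightarrow> self_adjoint (a + b)"
  by (simp add: self_adjoint_def adj_add)

lemma self_adjoint_i_commutator:
  "self_adjoint a \<Longrightarrow> self_adjoint b \<Longrightarrow> self_adjoint (\<i> *\<^sub>C commutator a b)"
  by (simp add: self_adjoint_def commutator_def adj_scaleC adj_diff adj_mult scaleC_diff_right
      scaleC_minus_left)

theorem theorem1p1:
  fixes \<tau> :: "'a::cstar_algebra \<Rightarrow> complex" and s x :: 'a
  assumes "cstar_prob_space \<tau>"
    and "semicircular \<tau> s"
    and "self_adjoint x"
    and "free_elems \<tau> s x"
  shows "distribution \<tau> (s + \<i> *\<^sub>C commutator s x) =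
           distribution \<tau> s \<boxplus> distribution \<tau> (\<i> *\<^sub>C commutator s x) \<and>
         ((\<nexists>c. x = c *\<^sub>C 1) \<longrightarrow> \<not> free_elems \<tau> s (\<i> *\<^sub>C commutator s x))"
proof -
  interpret cstar_prob_space \<tau> by fact
  let ?y = "\<i> *\<^sub>C commutator s x"
  define v where "v = elem_cumulant \<tau> s 2"
  have v: "v \<noteq> 0" and cum: "\<And>n. n \<ge> 1 \<Longrightarrow> elem_cumulant \<tau> s n = (if n = 2 then v else 0)"
    and s: "self_adjoint s"
    using assms(2) by (auto simp: semicircular_def v_def)
  interpret free_semicircular \<tau> s x v
    by unfold_locales (simp_all only: assms(4) v_def semicircular_moment_recursion[OF assms(2)])
  have y: "self_adjoint ?y" using s assms(3) by (rule self_adjoint_i_commutator)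
  have "distribution \<tau> (s + ?y) = distribution \<tau> s \<boxplus> distribution \<tau> ?y"
    by (rule distribution_eq_free_convolution[OF s y self_adjoint_add[OF s y]])
      (simp add: cumulant_add_commutator cum)
  then show ?thesis using not_free_commutator[OF assms(3) v] by blast
qed

end
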